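(* Let $t \geq 2$ be an integer. Every $K_t$-minor-free graph $G$ is isomorphic to a subgraph of $H \boxtimes P \boxtimes K_m$ for some path $P$ and some graph $H$ with $\mathrm{tw}(H) \leq t-2$, where $m := \mathrm{ltw}(G)$.
   Context: All graphs are finite, simple and undirected. $\mathrm{tw}$ denotes treewidth. A layering of $G$ is a partition $(V_1, V_2, \dots)$ of $V(G)$ such that for each edge $vw$ with $v \in V_i$, $w \in V_j$ we have $|i-j| \leq 1$. The layered treewidth $\mathrm{ltw}(G)$ is the minimum integer $k$ such that $G$ has a layering $\mathcal{L}$ and a tree-decomposition $(T,\mathcal{W})$ with $|L \cap W| \leq k$ for every layer $L$ and every bag $W$. The strong product $A \boxtimes B$ has vertex-set $V(A)\times V(B)$, where distinct $(v,x),(w,y)$ are adjacent if ($v=w$ and $xy\in E(B)$), or ($x=y$ and $vw\in E(A)$), or ($vw\in E(A)$ and $xy\in E(B)$). $K_m$ is the complete graph on $m$ vertices. *)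

theory Defs
  imports
    "Graph_Theory.Digraph_Component"
    "Graph_Theory.Digraph_Isomorphism"
    "Graph_Theory.Vertex_Walk"
    "Graph_Theory.Kuratowski"
begin

text \<open>
  Finite simple undirected graphs are the loop-free symmetric digraphs of the locale
  \<^locale>\<open>pair_graph\<close>: an edge \<open>uv\<close> is the pair of arcs \<open>(u,v)\<close>, \<open>(v,u)\<close>.
  The null graph is allowed.
\<close>

definition complete_graph :: "nat \<Rightarrow> nat pair_pre_digraph" where
  "complete_graph n =
     \<lparr> pverts = {..<n}, parcs = {(u, v). u < n \<and> v < n \<and> u \<noteq> v} \<rparr>"

definition is_path :: "'a pair_pre_digraph \<Rightarrow> bool" where
  "is_path P \<longleftrightarrow> (\<exists>xs. xs \<noteq> [] \<and> distinct xs \<and> pverts P = set xs \<and>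
     parcs P = set (vwalk_arcs xs) \<union> (set (vwalk_arcs xs))\<inverse>)"

definition strong_product ::
  "'a pair_pre_digraph \<Rightarrow> 'b pair_pre_digraph \<Rightarrow> ('a \<times> 'b) pair_pre_digraph"
  (infixl \<open>\<boxtimes>\<close> 70) where
  "A \<boxtimes> B = \<lparr> pverts = pverts A \<times> pverts B,
     parcs = {((v, x), (w, y)) | v x w y.
       (v, x) \<in> pverts A \<times> pverts B \<and> (w, y) \<in> pverts A \<times> pverts B \<and>
       (v = w \<and> (x, y) \<in> parcs B \<or>
        x = y \<and> (v, w) \<in> parcs A \<or>
        (v, w) \<in> parcs A \<and> (x, y) \<in> parcs B)} \<rparr>"

definition isomorphic_to_subgraph :: "'a pair_pre_digraph \<Rightarrow> 'b pair_pre_digraph \<Rightarrow> bool" where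
  "isomorphic_to_subgraph G X \<longleftrightarrow>
     (\<exists>S :: 'b pair_pre_digraph. pair_graph S \<and> subgraph (with_proj S) (with_proj X) \<and>
        digraph_iso (with_proj G) (with_proj S))"

text \<open>Contraction of the edge \<open>uv\<close>; the merged vertex keeps the name \<open>u\<close>.\<close>

definition contract_edge :: "'a pair_pre_digraph \<Rightarrow> 'a \<Rightarrow> 'a \<Rightarrow> 'a pair_pre_digraph" where
  "contract_edge G u v = (let f = (\<lambda>x. if x = v then u else x) in
     \<lparr> pverts = f ` pverts G,
       parcs = {(f a, f b) | a b. (a, b) \<in> parcs G \<and> f a \<noteq> f b} \<rparr>)"

inductive contracts_to :: "'a pair_pre_digraph \<Rightarrow> 'a pair_pre_digraph \<Rightarrow> bool" where
  refl: "contracts_to G G"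
| step: "contracts_to G G' \<Longrightarrow> (u, v) \<in> parcs G' \<Longrightarrow> contracts_to G (contract_edge G' u v)"

definition is_minor :: "'b pair_pre_digraph \<Rightarrow> 'a pair_pre_digraph \<Rightarrow> bool" where
  "is_minor M G \<longleftrightarrow> (\<exists>(S :: 'a pair_pre_digraph) G'.
     pair_graph S \<and> subgraph (with_proj S) (with_proj G) \<and> contracts_to S G' \<and>
     digraph_iso (with_proj M) (with_proj G'))"

definition minor_free :: "'b pair_pre_digraph \<Rightarrow> 'a pair_pre_digraph \<Rightarrow> bool" where
  "minor_free M G \<longleftrightarrow> \<not> is_minor M G"

text \<open>
  The library's \<^const>\<open>tree\<close> is unusable here, because in a symmetric digraph the closed
  walk \<open>a, b, a\<close> counts as a \<^const>\<open>pre_digraph.cycle\<close>. The cycles of the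
  underlying undirected graph are those of length at least three.
\<close>

definition is_tree :: "'a pair_pre_digraph \<Rightarrow> bool" where
  "is_tree T \<longleftrightarrow> pair_graph T \<and> Digraph_Component.connected (with_proj T) \<and>
     \<not> (\<exists>p. pre_digraph.cycle (with_proj T) p \<and> 3 \<le> length p)"

text \<open>
  \<^const>\<open>Digraph_Component.connected\<close> includes non-emptiness, so the last conjunct
  also says that every vertex lies in some bag.
\<close>

definition tree_decomposition ::
  "'a pair_pre_digraph \<Rightarrow> 'b pair_pre_digraph \<Rightarrow> ('b \<Rightarrow> 'a set) \<Rightarrow> bool" where
  "tree_decomposition G T W \<longleftrightarrow>
     is_tree T \<and>
     (\<forall>x\<in>pverts T. W x \<subseteq> pverts G) \<and>
     (\<forall>(u, v)\<in>parcs G. \<exists>x\<in>pverts T. u \<in> W x \<and> v \<in> W x) \<and>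
     (\<forall>v\<in>pverts G. Digraph_Component.connected (with_proj T \<restriction> {x\<in>pverts T. v \<in> W x}))"

text \<open>
  The subtraction truncates only if all bags are empty, so the null graph gets treewidth
  \<open>0\<close> instead of \<open>-1\<close>. Since trees are finite, taking their nodes to be natural numbers
  is no restriction.
\<close>

definition width :: "'b pair_pre_digraph \<Rightarrow> ('b \<Rightarrow> 'a set) \<Rightarrow> nat" where
  "width T W = Max ((\<lambda>x. card (W x)) ` pverts T) - 1"

definition treewidth :: "'a pair_pre_digraph \<Rightarrow> nat" where
  "treewidth G = (LEAST k. \<exists>(T :: nat pair_pre_digraph) W. tree_decomposition G T W \<and> width T W = k)"

text \<open>Layers may be empty; a finite sequence of layers is continued by empty ones.\<close>

definition layering :: "'a pair_pre_digraph \<Rightarrow> (nat \<Rightarrow> 'a set) \<Rightarrow> bool" where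
  "layering G L \<longleftrightarrow>
     (\<forall>i j. i \<noteq> j \<longrightarrow> L i \<inter> L j = {}) \<and> (\<Union>i. L i) = pverts G \<and>
     (\<forall>v w i j. (v, w) \<in> parcs G \<and> v \<in> L i \<and> w \<in> L j \<longrightarrow> \<bar>int i - int j\<bar> \<le> 1)"

definition layered_treewidth :: "'a pair_pre_digraph \<Rightarrow> nat" where
  "layered_treewidth G = (LEAST k. \<exists>L (T :: nat pair_pre_digraph) W.
     layering G L \<and> tree_decomposition G T W \<and>
     (\<forall>i. \<forall>x\<in>pverts T. card (L i \<inter> W x) \<le> k))"

lemma complete_graph_complete_digraph: "K\<^bsub>n\<^esub> (with_proj (complete_graph n))"
  by (auto simp: complete_digraph_pair_def complete_graph_def)

lemma pair_graph_strong_product: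
  assumes "pair_graph A" "pair_graph B"
  shows "pair_graph (A \<boxtimes> B)"
proof -
  interpret A: pair_graph A by fact
  interpret B: pair_graph B by fact
  have sub: "parcs (A \<boxtimes> B) \<subseteq> pverts (A \<boxtimes> B) \<times> pverts (A \<boxtimes> B)"
    by (auto simp: strong_product_def)
  have fin: "finite (pverts (A \<boxtimes> B))"
    by (simp add: strong_product_def)
  show ?thesis
  proof
    show "finite (parcs (A \<boxtimes> B))"
      using sub fin by (meson finite_SigmaI finite_subset)
    show "symmetric (with_proj (A \<boxtimes> B))"
      by (auto simp: symmetric_def sym_def strong_product_def
          dest: A.arcs_symmetric B.arcs_symmetric)
  qed (use sub fin in \<open>auto simp: strong_product_def dest: A.no_loops' B.no_loops'\<close>)
qed

lemma pair_graph_contract_edge: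
  assumes "pair_graph G" "(u, v) \<in> parcs G"
  shows "pair_graph (contract_edge G u v)" "pverts (contract_edge G u v) = pverts G - {v}"
proof -
  interpret G: pair_graph G by fact
  let ?C = "contract_edge G u v"
  have sub: "parcs ?C \<subseteq> pverts ?C \<times> pverts ?C"
    by (auto simp: contract_edge_def Let_def dest: G.in_arcsD1 G.in_arcsD2)
  have loopfree: "fst e \<noteq> snd e" if "e \<in> parcs ?C" for e
    using that by (auto simp: contract_edge_def Let_def)
  have fin: "finite (pverts ?C)"
    by (simp add: contract_edge_def Let_def)
  show "pair_graph ?C"
  proof
    show "finite (parcs ?C)"
      using sub fin by (meson finite_SigmaI finite_subset)
    show "symmetric (with_proj ?C)"
      unfolding symmetric_def sym_def contract_edge_def Let_def
      using G.arcs_symmetric by simp blast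
  qed (use sub fin loopfree in auto)
  show "pverts ?C = pverts G - {v}"
    using assms(2) G.no_loops' G.in_arcsD1 by (auto simp: contract_edge_def Let_def)
qed

end

theory Submission
  imports Defs
begin

text \<open>
  Fix a layering and a tree-decomposition \<open>(T, W)\<close> of \<open>G\<close> realising the layered treewidth. It suffices
  to partition \<open>V(G)\<close> into parts, each inside a single bag, whose quotient \<open>H\<close> has treewidth at most
  \<open>t - 2\<close>: a part then meets each layer in at most \<open>m\<close> vertices.

  The parts are chosen one at a time. Every component \<open>C\<close> of the rest is adjacent only to parts
  \<open>X\<^sub>1, \<dots>, X\<^sub>r\<close> contained in branch sets \<open>A\<^sub>1, \<dots>, A\<^sub>r\<close> of a complete minor, all of them adjacent to
  \<open>C\<close>; as \<open>C\<close> is a further branch set, \<open>r \<le> t - 2\<close>, and a bag \<open>{X\<^sub>1, \<dots>, X\<^sub>r, X}\<close> can be added to a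
  tree-decomposition of \<open>H\<close> for a new part \<open>X \<subseteq> C\<close>. To choose \<open>X\<close>, call a connected subset of \<open>C\<close> full
  if it is adjacent to every \<open>A\<^sub>i\<close>.

  If some bag meets every full set, let \<open>X\<close> be a minimal subset of it that does. A component \<open>C'\<close> of
  \<open>C - X\<close> misses some \<open>A\<^sub>i\<close>, and by minimality \<open>A\<^sub>i\<close> can be enlarged outside \<open>C'\<close> to contain \<open>X\<close>.

  Otherwise, for each node \<open>x\<close> of \<open>T\<close> some full component of \<open>C - W x\<close> lives in one component of \<open>T - x\<close>.
  Orienting \<open>x\<close> towards it, some edge of \<open>T\<close> is oriented both ways, which gives disjoint full sets
  \<open>U\<close> and \<open>D\<close> such that the neighbours of \<open>U\<close> in \<open>C\<close> lie in one bag. Let \<open>K\<close> be the component of \<open>C - U\<close>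
  containing \<open>D\<close> and \<open>X\<close> the set of neighbours of \<open>U\<close> in \<open>K\<close>. Each component of \<open>C - X\<close> is disjoint
  from one of the full sets \<open>K\<close> and \<open>U \<union> X\<close>, which both contain \<open>X\<close>.
\<close>

section \<open>Connected sets in a symmetric relation\<close>

text \<open>Graphs enter as bare arc relations, so that the same notions serve \<open>G\<close> and
  the tree of its decomposition.\<close>

definition connected_in :: "'a rel \<Rightarrow> 'a set \<Rightarrow> bool" where
  "connected_in E A \<longleftrightarrow> A \<noteq> {} \<and> (\<forall>a\<in>A. \<forall>b\<in>A. (a, b) \<in> (E \<inter> A \<times> A)\<^sup>*)"

definition touches :: "'a rel \<Rightarrow> 'a set \<Rightarrow> 'a set \<Rightarrow> bool" where
  "touches E A B \<longleftrightarrow> (\<exists>a\<in>A. \<exists>b\<in>B. (a, b) \<in> E)"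

definition is_component :: "'a rel \<Rightarrow> 'a set \<Rightarrow> 'a set \<Rightarrow> bool" where
  "is_component E A C \<longleftrightarrow>
     connected_in E C \<and> C \<subseteq> A \<and> (\<forall>b\<in>C. \<forall>c\<in>A. (b, c) \<in> E \<longrightarrow> c \<in> C)"

lemma touches_sym: "sym E \<Longrightarrow> touches E A B \<Longrightarrow> touches E B A"
  unfolding touches_def by (meson symD)

lemma touches_mono: "touches E A B \<Longrightarrow> A \<subseteq> A' \<Longrightarrow> B \<subseteq> B' \<Longrightarrow> touches E A' B'"
  unfolding touches_def by blast

text \<open>If no arc left \<open>B\<close>, a path starting in \<open>B\<close> could never leave
  it, by induction. This lemma and its converse below let later arguments use cuts instead of
  paths.\<close>

lemma connected_in_cut:
  assumes "connected_in E A" "B \<subseteq> A" "B \<noteq> {}" "B \<noteq> A"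
  shows "touches E B (A - B)"
proof (rule ccontr)
  assume no: "\<not> touches E B (A - B)"
  obtain a b where ab: "a \<in> B" "b \<in> A - B" using assms by blast
  then have "(a, b) \<in> (E \<inter> A \<times> A)\<^sup>*"
    using assms unfolding connected_in_def by blast
  then have "b \<in> B"
    by induction (use ab no in \<open>auto simp: touches_def\<close>)
  with ab show False by blast
qed

text \<open>The vertices reachable from \<open>a\<close> form a set with no outgoing arc, so the cut
  condition forces it to be all of \<open>A\<close>.\<close>

lemma connected_inI_cut:
  assumes "A \<noteq> {}"
    and cut: "\<And>B. B \<subseteq> A \<Longrightarrow> B \<noteq> {} \<Longrightarrow> B \<noteq> A \<Longrightarrow> touches E B (A - B)"
  shows "connected_in E A"
  unfolding connected_in_def
proof (intro conjI ballI)
  fix a b assume a: "a \<in> A" and b: "b \<in> A"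
  define B where "B = {c \<in> A. (a, c) \<in> (E \<inter> A \<times> A)\<^sup>*}"
  have "\<not> touches E B (A - B)"
    unfolding touches_def B_def by (auto intro: rtrancl.rtrancl_into_rtrancl)
  then have "B = A"
    using cut[of B] a unfolding B_def by blast
  then show "(a, b) \<in> (E \<inter> A \<times> A)\<^sup>*"
    using b unfolding B_def by blast
qed fact

text \<open>A cut \<open>S\<close> that splits neither set must be \<open>A\<close> or
  \<open>B\<close> itself, with \<open>A\<close> and \<open>B\<close> disjoint; then the arc between
  them crosses the cut, possibly after reversal.\<close>

lemma connected_in_Un:
  assumes "sym E" "connected_in E A" "connected_in E B" "A \<inter> B \<noteq> {} \<or> touches E A B"
  shows "connected_in E (A \<union> B)"
proof (rule connected_inI_cut)
  show "A \<union> B \<noteq> {}" using assms unfolding connected_in_def by blast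
  fix S assume S: "S \<subseteq> A \<union> B" "S \<noteq> {}" "S \<noteq> A \<union> B"
  have inside: "touches E S (A \<union> B - S)"
    if "connected_in E D" "D \<subseteq> A \<union> B" "D \<inter> S \<noteq> {}" "\<not> D \<subseteq> S" for D
    using connected_in_cut[of E D "D \<inter> S"] that by (auto simp: touches_def)
  show "touches E S (A \<union> B - S)"
  proof (cases "(A \<inter> S \<noteq> {} \<and> \<not> A \<subseteq> S) \<or> (B \<inter> S \<noteq> {} \<and> \<not> B \<subseteq> S)")
    case True
    then show ?thesis using inside[of A] inside[of B] assms by blast
  next
    case False
    then have "(S = A \<or> S = B) \<and> A \<inter> B = {}" using S by blast
    then show ?thesis
      using assms touches_sym[of E A B] S by (auto simp: touches_def)
  qed
qed

lemma connected_in_insert_neighbours: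
  assumes "sym E" "connected_in E U" "\<forall>x\<in>X. \<exists>u\<in>U. (u, x) \<in> E"
  shows "connected_in E (U \<union> X)"
proof (rule connected_inI_cut)
  show "U \<union> X \<noteq> {}" using assms unfolding connected_in_def by blast
  fix S assume S: "S \<subseteq> U \<union> X" "S \<noteq> {}" "S \<noteq> U \<union> X"
  show "touches E S (U \<union> X - S)"
  proof (cases "U \<inter> S = {} \<or> U \<subseteq> S")
    case True
    then show ?thesis
    proof
      assume "U \<inter> S = {}"
      then obtain x where "x \<in> S" "x \<in> X" using S by blast
      then obtain u where "u \<in> U" "(x, u) \<in> E" using assms by (meson symD)
      then show ?thesis using \<open>U \<inter> S = {}\<close> \<open>x \<in> S\<close> unfolding touches_def by blast
    next
      assume "U \<subseteq> S"
      then obtain x where x: "x \<in> X" "x \<notin> S" using S by blast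
      then show ?thesis using assms(3) \<open>U \<subseteq> S\<close> unfolding touches_def by blast
    qed
  next
    case False
    then show ?thesis
      using connected_in_cut[OF assms(2), of "U \<inter> S"] by (auto simp: touches_def)
  qed
qed

lemma connected_in_singleton: "connected_in E {a}"
  unfolding connected_in_def by simp

text \<open>An arc leaving \<open>D \<inter> C\<close> within \<open>D\<close> would also leave
  \<open>C\<close> within \<open>A\<close>.\<close>

lemma component_superset:
  assumes "sym E" "is_component E A C" "connected_in E D" "D \<subseteq> A" "D \<inter> C \<noteq> {}"
  shows "D \<subseteq> C"
  using connected_in_cut[OF assms(3), of "D \<inter> C"] assms
  unfolding is_component_def touches_def by blast

lemma component_exists:
  assumes "sym E" "connected_in E D" "D \<subseteq> A"
  shows "\<exists>C. is_component E A C \<and> D \<subseteq> C"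
proof -
  obtain d where d: "d \<in> D" using assms unfolding connected_in_def by blast
  define C where "C = {c \<in> A. (d, c) \<in> (E \<inter> A \<times> A)\<^sup>*}"
  have dC: "d \<in> C" using d assms unfolding C_def by blast
  have closed: "c \<in> C" if "b \<in> C" "c \<in> A" "(b, c) \<in> E" for b c
    using that unfolding C_def by (auto intro: rtrancl.rtrancl_into_rtrancl)
  have "connected_in E C"
  proof (rule connected_inI_cut)
    fix S assume S: "S \<subseteq> C" "S \<noteq> {}" "S \<noteq> C"
    \<comment> \<open>A subset of \<open>C\<close> that contains \<open>d\<close> and has no exit
      within \<open>C\<close> is all of \<open>C\<close>. Cuts that do not contain \<open>d\<close>
      are handled through their complements.\<close>
    have reach: "x \<in> S'" if "S' \<subseteq> C" "d \<in> S'" "\<not> touches E S' (C - S')" "x \<in> C" for x S'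
    proof -
      have "(d, x) \<in> (E \<inter> A \<times> A)\<^sup>*" using that(4) unfolding C_def by blast
      then show ?thesis
      proof induction
        case (step y z)
        then have "z \<in> C" using closed[of y z] that(1) by blast
        then show ?case using step that(3) unfolding touches_def by blast
      qed fact
    qed
    show "touches E S (C - S)"
    proof (cases "d \<in> S")
      case True
      then show ?thesis using reach[of S] S by blast
    next
      case False
      then have "touches E (C - S) (C - (C - S))"
        using reach[of "C - S"] S dC by blast
      moreover have "C - (C - S) = S" using S by blast
      ultimately show ?thesis using touches_sym[OF assms(1)] by metis
    qed
  qed (use dC in blast)
  then have comp: "is_component E A C"
    unfolding is_component_def using closed C_def by blast
  then show ?thesis using component_superset[OF assms(1) comp assms(2,3)] d dC by blast
qed

text \<open>The link from \<open>z\<close> to \<open>A\<close> inside \<open>D\<close> can avoid \<open>C'\<close>, since \<open>D\<close> leaves \<open>C'\<close> only through \<open>z\<close>.\<close>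

lemma link_avoiding_component:
  assumes "sym E" "connected_in E D" "D \<subseteq> C" "D \<inter> Z = {z}"
    and comp: "is_component E (C - Z) C'"
    and "connected_in E A" "touches E A D" "\<not> touches E A C'" "A \<inter> C = {}"
  shows "\<exists>R. connected_in E R \<and> A \<subseteq> R \<and> z \<in> R \<and> R \<subseteq> A \<union> (C - C')"
proof -
  obtain d a where d: "d \<in> D" "a \<in> A" "(a, d) \<in> E"
    using assms unfolding touches_def by blast
  have dC': "d \<notin> C'" using d assms unfolding touches_def by blast
  have z: "z \<in> D" "z \<in> Z" using assms by auto
  have zC': "z \<notin> C'" using comp z unfolding is_component_def by blast
  obtain K where K: "is_component E (D - C') K" "{d} \<subseteq> K"
    using component_exists[OF assms(1) connected_in_singleton, of d "D - C'"] d dC' by blast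
  \<comment> \<open>If \<open>z\<close> were missed, an arc would leave \<open>K\<close> within
    \<open>D\<close> and end in \<open>C'\<close>. Its start lies in \<open>C - Z\<close>, so
    closure of the component \<open>C'\<close> would put the start in \<open>C'\<close> too.\<close>
  have "z \<in> K"
  proof (rule ccontr)
    assume zK: "z \<notin> K"
    have "K \<subseteq> D" "K \<noteq> {}" "K \<noteq> D" using K zK z unfolding is_component_def by auto
    then obtain k e where ke: "k \<in> K" "e \<in> D - K" "(k, e) \<in> E"
      using connected_in_cut[OF assms(2)] unfolding touches_def by blast
    then have "e \<in> C'" using K unfolding is_component_def by blast
    moreover have "k \<in> C - Z" "k \<notin> C'"
      using K ke zK assms(3,4) unfolding is_component_def by auto
    ultimately show False
      using comp ke(3) assms(1) unfolding is_component_def by (meson symD)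
  qed
  moreover have "connected_in E (A \<union> K)"
  proof (rule connected_in_Un[OF assms(1)])
    show "connected_in E K" using K(1) unfolding is_component_def by blast
    show "A \<inter> K \<noteq> {} \<or> touches E A K" using K(2) d(2,3) unfolding touches_def by blast
  qed fact
  moreover have "A \<union> K \<subseteq> A \<union> (C - C')"
    using K assms(3) unfolding is_component_def by blast
  ultimately show ?thesis by (intro exI[of _ "A \<union> K"]) blast
qed

text \<open>Every cut \<open>S\<close> splits some \<open>R i\<close>: one that meets
  \<open>S\<close> if \<open>S\<close> misses \<open>A\<close>, and otherwise one that is not
  contained in \<open>S\<close>.\<close>

lemma connected_in_Union_common:
  assumes "sym E" "\<And>i. i \<in> I \<Longrightarrow> connected_in E (R i)" "\<And>i. i \<in> I \<Longrightarrow> A \<subseteq> R i"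
    and "A \<noteq> {}" "I \<noteq> {}"
  shows "connected_in E (\<Union>i\<in>I. R i)"
proof (rule connected_inI_cut)
  show "(\<Union>i\<in>I. R i) \<noteq> {}" using assms by blast
  fix S assume S: "S \<subseteq> (\<Union>i\<in>I. R i)" "S \<noteq> {}" "S \<noteq> (\<Union>i\<in>I. R i)"
  obtain i where "i \<in> I" "R i \<inter> S \<noteq> {}" "\<not> R i \<subseteq> S"
  proof (cases "A \<inter> S = {}")
    case True
    obtain s i where "s \<in> S" "i \<in> I" "s \<in> R i" using S by blast
    then show ?thesis using that[of i] True assms(3)[of i] assms(4) by blast
  next
    case False
    obtain s i where "s \<notin> S" "i \<in> I" "s \<in> R i" using S by blast
    then show ?thesis using that[of i] False assms(3)[of i] by blast
  qed
  then show "touches E S ((\<Union>i\<in>I. R i) - S)"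
    using connected_in_cut[OF assms(2)[of i], of "R i \<inter> S"] by (auto simp: touches_def)
qed

section \<open>Branch sets of complete minors and the choice of one part\<close>

definition is_model :: "'a rel \<Rightarrow> 'b set \<Rightarrow> ('b \<Rightarrow> 'a set) \<Rightarrow> bool" where
  "is_model E Q A \<longleftrightarrow> (\<forall>j\<in>Q. connected_in E (A j)) \<and>
     (\<forall>i\<in>Q. \<forall>j\<in>Q. i \<noteq> j \<longrightarrow> A i \<inter> A j = {} \<and> touches E (A i) (A j))"

text \<open>\<open>B\<close> is a candidate branch set around the new part \<open>X\<close>, with a
  view to the component \<open>C'\<close>. Only the sets \<open>A j\<close> touching
  \<open>C'\<close> constrain it; the others are discarded later, so \<open>B\<close> may absorb
  them.\<close>

definition extends_model :: "'a rel \<Rightarrow> 'b set \<Rightarrow> ('b \<Rightarrow> 'a set) \<Rightarrow> 'a set \<Rightarrow> 'a set \<Rightarrow> 'a set \<Rightarrow> bool"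
  where "extends_model E Q A X C' B \<longleftrightarrow> connected_in E B \<and> X \<subseteq> B \<and> B \<inter> C' = {} \<and>
     (\<forall>j\<in>Q. touches E (A j) C' \<longrightarrow> B \<inter> A j = {} \<and> touches E B (A j))"

definition full :: "'a rel \<Rightarrow> 'b set \<Rightarrow> ('b \<Rightarrow> 'a set) \<Rightarrow> 'a set \<Rightarrow> 'a set \<Rightarrow> bool" where
  "full E Q A C D \<longleftrightarrow> D \<subseteq> C \<and> connected_in E D \<and> (\<forall>j\<in>Q. touches E (A j) D)"

text \<open>By minimality each \<open>z\<close> in \<open>X\<close> is the only point of
  \<open>X\<close> in some full set \<open>D\<close>. If \<open>A i\<close> does not touch
  \<open>C'\<close>, a link inside \<open>D\<close> joins \<open>A i\<close> to \<open>z\<close>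
  outside \<open>C'\<close>; \<open>B\<close> is \<open>A i\<close> together with all these
  links.\<close>

lemma part_if_hit:
  assumes "sym E" "finite C" and model: "is_model E Q A"
    and disj: "\<And>j. j \<in> Q \<Longrightarrow> A j \<inter> C = {}"
    and fullC: "full E Q A C C"
    and hit: "\<And>D. full E Q A C D \<Longrightarrow> D \<inter> Y \<noteq> {}"
  shows "\<exists>X\<subseteq>C. X \<noteq> {} \<and> X \<subseteq> Y \<and>
    (\<forall>C'. is_component E (C - X) C' \<longrightarrow> (\<exists>B. B \<subseteq> C \<union> (\<Union>j\<in>Q. A j) \<and> extends_model E Q A X C' B))"
proof -
  define hits where "hits X \<longleftrightarrow> X \<subseteq> C \<inter> Y \<and> (\<forall>D. full E Q A C D \<longrightarrow> D \<inter> X \<noteq> {})" for X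
  have "hits (C \<inter> Y)" using hit unfolding hits_def full_def by blast
  then obtain X where X: "hits X" and min: "\<And>X'. hits X' \<Longrightarrow> card X \<le> card X'"
    using ex_has_least_nat[of hits _ card] by blast
  have fin: "finite X" using X assms(2) unfolding hits_def by (meson finite_Int finite_subset)
  have "\<exists>B. B \<subseteq> C \<union> (\<Union>j\<in>Q. A j) \<and> extends_model E Q A X C' B"
    if C': "is_component E (C - X) C'" for C'
  proof -
    have "\<not> full E Q A C C'"
      using X C' unfolding hits_def is_component_def by blast
    then obtain i where i: "i \<in> Q" "\<not> touches E (A i) C'"
      using C' unfolding full_def is_component_def by blast
    have "\<exists>R. connected_in E R \<and> A i \<subseteq> R \<and> z \<in> R \<and> R \<subseteq> A i \<union> (C - C')" if z: "z \<in> X" for z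
    proof -
      have "\<not> hits (X - {z})" using min[of "X - {z}"] z fin
        by (metis card_Diff1_less linorder_not_le)
      then obtain D where D: "full E Q A C D" "D \<inter> (X - {z}) = {}"
        using X unfolding hits_def by blast
      then have "D \<inter> X = {z}" using X z unfolding hits_def by blast
      then show ?thesis
        using link_avoiding_component[OF assms(1), of D C X z C' "A i"] D C' i disj[of i] model
        unfolding full_def is_model_def by blast
    qed
    then obtain R where R: "\<And>z. z \<in> X \<Longrightarrow> connected_in E (R z) \<and> A i \<subseteq> R z \<and> z \<in> R z
        \<and> R z \<subseteq> A i \<union> (C - C')"
      by metis
    define B where "B = (\<Union>z\<in>X. R z)"
    have ne: "X \<noteq> {}" using X fullC unfolding hits_def by blast
    have Ai: "A i \<noteq> {}" using model i unfolding is_model_def connected_in_def by blast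
    have "connected_in E B" unfolding B_def
      by (rule connected_in_Union_common[OF assms(1), where A="A i"]) (use R ne Ai in auto)
    moreover have "X \<subseteq> B" using R unfolding B_def by blast
    moreover have Bsub: "B \<subseteq> A i \<union> (C - C')" "A i \<subseteq> B" using R ne unfolding B_def by blast+
    moreover have "B \<inter> C' = {}"
      using Bsub disj[OF i(1)] C' unfolding is_component_def by blast
    \<comment> \<open>\<open>A j\<close> touches \<open>C'\<close> and \<open>A i\<close> does not,
      so \<open>i\<close> and \<open>j\<close> differ. \<open>A j\<close> avoids both
      \<open>A i\<close> and \<open>C\<close>, and \<open>A i \<subseteq> B\<close> supplies the
      adjacency.\<close>
    moreover have "B \<inter> A j = {} \<and> touches E B (A j)" if "j \<in> Q" "touches E (A j) C'" for j
    proof -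
      have "i \<noteq> j" using i that by blast
      then have "A i \<inter> A j = {}" "touches E (A i) (A j)"
        using model i that unfolding is_model_def by blast+
      then show ?thesis using Bsub disj[OF that(1)] touches_mono by blast
    qed
    ultimately show ?thesis
      unfolding extends_model_def using i by (intro exI[of _ B]) blast
  qed
  moreover have "X \<noteq> {}" using X fullC unfolding hits_def by blast
  ultimately show ?thesis using X unfolding hits_def by (intro exI[of _ X]) blast
qed

text \<open>All arcs between \<open>K\<close> and the rest of \<open>C\<close> run between
  \<open>X\<close> and \<open>U\<close>. A component of \<open>C - X\<close> therefore lies inside
  \<open>K\<close>, and \<open>U \<union> X\<close> is the branch set, or outside \<open>K\<close>,
  and \<open>K\<close> itself is.\<close>

lemma part_if_disjoint:
  assumes "sym E" 
    and disj: "\<And>j. j \<in> Q \<Longrightarrow> A j \<inter> C = {}"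
    and C: "connected_in E C"
    and U: "full E Q A C U" and D: "full E Q A C D" and UD: "U \<inter> D = {}"
    and nb: "\<And>u c. u \<in> U \<Longrightarrow> c \<in> C - U \<Longrightarrow> (u, c) \<in> E \<Longrightarrow> c \<in> Y"
  shows "\<exists>X\<subseteq>C. X \<noteq> {} \<and> X \<subseteq> Y \<and>
    (\<forall>C'. is_component E (C - X) C' \<longrightarrow> (\<exists>B. B \<subseteq> C \<union> (\<Union>j\<in>Q. A j) \<and> extends_model E Q A X C' B))"
proof -
  have UC: "U \<subseteq> C" "U \<noteq> {}" "connected_in E U" and DC: "D \<subseteq> C - U" "D \<noteq> {}" "connected_in E D"
    using U D UD unfolding full_def connected_in_def by auto
  obtain K where K: "is_component E (C - U) K" "D \<subseteq> K"
    using component_exists[OF assms(1) DC(3,1)] by blast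
  define X where "X = {c \<in> K. \<exists>u\<in>U. (u, c) \<in> E}"
  have Kc: "K \<subseteq> C - U" "K \<noteq> {}" "connected_in E K" using K DC unfolding is_component_def by auto
  have out: "b \<in> U \<and> a \<in> X" if "a \<in> K" "b \<in> C - K" "(a, b) \<in> E" for a b
  proof -
    have "b \<in> U" using that K unfolding is_component_def by blast
    then show ?thesis using that assms(1) unfolding X_def by (auto dest: symD)
  qed
  \<comment> \<open>\<open>C\<close> is connected and \<open>U\<close> lies outside
    \<open>K\<close>, so \<open>K\<close> has an exit arc within \<open>C\<close>, which starts in
    \<open>X\<close>.\<close>
  have "touches E K (C - K)" by (rule connected_in_cut[OF C]) (use Kc UC in auto)
  then have "X \<noteq> {}" using out unfolding touches_def by blast
  moreover have "X \<subseteq> C" "X \<subseteq> Y" using Kc nb unfolding X_def by auto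
  moreover have "\<exists>B. B \<subseteq> C \<union> (\<Union>j\<in>Q. A j) \<and> extends_model E Q A X C' B"
    if C': "is_component E (C - X) C'" for C'
  proof (cases "C' \<inter> K = {}")
    case True
    have "touches E K (A j)" "K \<inter> A j = {}" if "j \<in> Q" for j
    proof -
      have "touches E (A j) K" using D that K touches_mono[of E "A j" D "A j" K] unfolding full_def by blast
      then show "touches E K (A j)" by (rule touches_sym[OF assms(1)])
      show "K \<inter> A j = {}" using disj[OF that] Kc by blast
    qed
    then show ?thesis using True Kc X_def
      by (intro exI[of _ K]) (auto simp: extends_model_def)
  next
    case False
    have "C' \<subseteq> K"
    proof (rule ccontr)
      assume "\<not> C' \<subseteq> K"
      then have "touches E (C' \<inter> K) (C' - C' \<inter> K)"
        using connected_in_cut[of E C' "C' \<inter> K"] C' False unfolding is_component_def by blast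
      then obtain a b where "a \<in> C' \<inter> K" "b \<in> C' - K" "(a, b) \<in> E"
        unfolding touches_def by blast
      then show False using out[of a b] C' unfolding is_component_def by blast
    qed
    then have "(U \<union> X) \<inter> C' = {}" using Kc C' unfolding is_component_def by blast
    moreover have "connected_in E (U \<union> X)"
      by (rule connected_in_insert_neighbours[OF assms(1) UC(3)]) (auto simp: X_def)
    moreover have "touches E (U \<union> X) (A j)" "(U \<union> X) \<inter> A j = {}" if "j \<in> Q" for j
    proof -
      have "touches E (A j) (U \<union> X)"
        using U that touches_mono[of E "A j" U "A j" "U \<union> X"] unfolding full_def by blast
      then show "touches E (U \<union> X) (A j)" by (rule touches_sym[OF assms(1)])
      show "(U \<union> X) \<inter> A j = {}" using disj[OF that] UC \<open>X \<subseteq> C\<close> by blast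
    qed
    ultimately show ?thesis using UC \<open>X \<subseteq> C\<close>
      by (intro exI[of _ "U \<union> X"]) (auto simp: extends_model_def)
  qed
  ultimately show ?thesis by (intro exI[of _ X]) blast
qed

section \<open>Bags of a tree-decomposition\<close>

lemma component_containing:
  assumes "sym E" "a \<in> A"
  shows "\<exists>C. is_component E A C \<and> a \<in> C"
  using component_exists[OF assms(1) connected_in_singleton, of a A] assms(2) by auto

text \<open>The last conjunct of \<open>tree_like\<close> expresses that no cycle passes through \<open>y\<close>.\<close>

definition tree_like :: "'b rel \<Rightarrow> 'b set \<Rightarrow> bool" where
  "tree_like R I \<longleftrightarrow> sym R \<and> finite I \<and> connected_in R I \<and>
     (\<forall>x y w D. (y, w) \<in> R \<and> (y, x) \<in> R \<and> D \<subseteq> I - {y} \<and> connected_in R D \<and>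
        w \<in> D \<and> x \<in> D \<longrightarrow> w = x)"

definition decomposes :: "'a set \<Rightarrow> 'a rel \<Rightarrow> 'b rel \<Rightarrow> 'b set \<Rightarrow> ('b \<Rightarrow> 'a set) \<Rightarrow> bool" where
  "decomposes V E R I W \<longleftrightarrow>
     (\<forall>v\<in>V. connected_in R {x\<in>I. v \<in> W x}) \<and> (\<forall>(u, v)\<in>E. \<exists>x\<in>I. u \<in> W x \<and> v \<in> W x)"

text \<open>The connected set \<open>I\<close> has an arc leaving \<open>S\<close>, and within
  \<open>I\<close> it can only end in \<open>x\<close>.\<close>

lemma component_neighbour:
  assumes "tree_like R I" "x \<in> I" "is_component R (I - {x}) S"
  shows "\<exists>y\<in>S. (x, y) \<in> R"
proof -
  have "touches R S (I - S)"
    by (rule connected_in_cut)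
      (use assms in \<open>auto simp: tree_like_def is_component_def connected_in_def\<close>)
  then obtain a b where ab: "a \<in> S" "b \<in> I - S" "(a, b) \<in> R"
    unfolding touches_def by blast
  then have "b = x" using assms(3) unfolding is_component_def by blast
  then show ?thesis using ab assms(1) unfolding tree_like_def by (auto dest: symD)
qed

text \<open>A common node \<open>z\<close> would lie in a component \<open>K\<close> of
  \<open>S - {y}\<close> that contains a neighbour \<open>w\<close> of \<open>y\<close>. Then
  \<open>K \<union> S'\<close> joins the neighbours \<open>w\<close> and \<open>x\<close> of
  \<open>y\<close> while avoiding \<open>y\<close>, so \<open>w = x\<close>; but \<open>x\<close> is
  not in \<open>S\<close>.\<close>

lemma tree_like_components_disjoint:
  assumes tree: "tree_like R I" and x: "x \<in> I" and y: "y \<in> S"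
    and S: "is_component R (I - {x}) S" and S': "is_component R (I - {y}) S'"
    and xy: "(x, y) \<in> R" and xS': "x \<in> S'"
  shows "S \<inter> S' = {}"
proof (rule ccontr)
  have symR: "sym R" using tree unfolding tree_like_def by blast
  assume "S \<inter> S' \<noteq> {}"
  then obtain z where z: "z \<in> S" "z \<in> S'" by blast
  have "z \<noteq> y" using z S' unfolding is_component_def by blast
  then obtain K where K: "is_component R (S - {y}) K" "z \<in> K"
    using component_containing[OF symR, of z "S - {y}"] z by blast
  have "touches R K (S - K)"
    by (rule connected_in_cut) (use S K y in \<open>auto simp: is_component_def\<close>)
  then obtain w b where w: "w \<in> K" "b \<in> S - K" "(w, b) \<in> R"
    unfolding touches_def by blast
  then have "b = y" using K unfolding is_component_def by blast
  then have yw: "(y, w) \<in> R" using w symR by (auto dest: symD)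
  have "w \<noteq> x" using w K S unfolding is_component_def by blast
  moreover have "connected_in R (K \<union> S')"
    using connected_in_Un[OF symR, of K S'] K S' z unfolding is_component_def by blast
  moreover have "K \<union> S' \<subseteq> I - {y}"
    using K S S' unfolding is_component_def by blast
  moreover have "(y, x) \<in> R" using xy symR by (auto dest: symD)
  ultimately show False
    using tree yw w(1) xS' unfolding tree_like_def by blast
qed

text \<open>For \<open>u\<close> in \<open>U\<close> the nodes whose bags contain \<open>u\<close>
  form a connected set avoiding \<open>x\<close>, hence stay in one component. Adjacent vertices
  share a bag, so the component is the same for all of \<open>U\<close>.\<close>

lemma nodes_in_one_component:
  assumes "sym R" and dec: "decomposes V E R I W"
    and U: "connected_in E U" "U \<subseteq> V" "U \<inter> W x = {}"
  shows "\<exists>S. is_component R (I - {x}) S \<and> (\<forall>u\<in>U. {i\<in>I. u \<in> W i} \<subseteq> S)"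
proof -
  have conn: "connected_in R {i\<in>I. u \<in> W i}" "{i\<in>I. u \<in> W i} \<subseteq> I - {x}" if "u \<in> U" for u
    using dec U that unfolding decomposes_def by auto
  obtain u0 where u0: "u0 \<in> U" using U unfolding connected_in_def by blast
  obtain S where S: "is_component R (I - {x}) S" "{i\<in>I. u0 \<in> W i} \<subseteq> S"
    using component_exists[OF assms(1) conn[OF u0]] by blast
  have "{u\<in>U. {i\<in>I. u \<in> W i} \<subseteq> S} = U" (is "?U' = U")
  proof (rule ccontr)
    assume "?U' \<noteq> U"
    moreover have "u0 \<in> ?U'" using u0 S by blast
    ultimately have "touches E ?U' (U - ?U')"
      using connected_in_cut[OF U(1), of ?U'] by blast
    then obtain u v where uv: "u \<in> ?U'" "v \<in> U - ?U'" "(u, v) \<in> E"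
      unfolding touches_def by blast
    then obtain i where "i \<in> I" "u \<in> W i" "v \<in> W i"
      using dec unfolding decomposes_def by blast
    then have "{i\<in>I. v \<in> W i} \<inter> S \<noteq> {}" using uv by blast
    then have "{i\<in>I. v \<in> W i} \<subseteq> S"
      using component_superset[OF assms(1) S(1) conn] uv by blast
    then show False using uv by blast
  qed
  then show ?thesis using S by blast
qed

text \<open>The edge oriented both ways is found by minimality: among all nodes \<open>x\<close> and
  components \<open>S\<close> that \<open>x\<close> can be oriented towards, take a pair with the
  fewest nodes in \<open>S\<close>. The neighbour \<open>y\<close> of \<open>x\<close> in
  \<open>S\<close> must then be oriented back towards \<open>x\<close>.\<close>

lemma bag_hits_or_disjoint:
  assumes "sym E" and tree: "tree_like R I" and dec: "decomposes V E R I W" and CV: "C \<subseteq> V"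
  shows "(\<exists>x\<in>I. \<forall>D. full E Q A C D \<longrightarrow> D \<inter> W x \<noteq> {}) \<or>
    (\<exists>x\<in>I. \<exists>U D. full E Q A C U \<and> full E Q A C D \<and> U \<inter> D = {} \<and>
       (\<forall>u\<in>U. \<forall>c\<in>C - U. (u, c) \<in> E \<longrightarrow> c \<in> W x))"
proof (rule disj_imp[THEN iffD2], rule impI)
  assume nohit: "\<not> (\<exists>x\<in>I. \<forall>D. full E Q A C D \<longrightarrow> D \<inter> W x \<noteq> {})"
  have symR: "sym R" and finI: "finite I" and conI: "connected_in R I"
    using tree unfolding tree_like_def by auto
  define points where "points x S U \<longleftrightarrow> full E Q A C U \<and> 
    (\<forall>u\<in>U. \<forall>c\<in>C - U. (u, c) \<in> E \<longrightarrow> c \<in> W x) \<and>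
    is_component R (I - {x}) S \<and> (\<forall>u\<in>U. {i\<in>I. u \<in> W i} \<subseteq> S)" for x S U
  have ex: "\<exists>S U. points x S U" if x: "x \<in> I" for x
  proof -
    obtain D where D: "full E Q A C D" "D \<inter> W x = {}" using nohit x by blast
    then have "connected_in E D" "D \<subseteq> C - W x" unfolding full_def by auto
    \<comment> \<open>Enlarging the full set \<open>D\<close> to a component of
      \<open>C - W x\<close> confines its neighbours in \<open>C\<close> to the bag
      \<open>W x\<close>.\<close>
    then obtain U where U: "is_component E (C - W x) U" "D \<subseteq> U"
      using component_exists[OF assms(1)] by blast
    then have Uc: "connected_in E U" "U \<subseteq> C" "U \<inter> W x = {}" unfolding is_component_def by auto
    have "full E Q A C U"
      using D Uc U(2) touches_mono[of E _ D _ U] unfolding full_def by blast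
    moreover have "\<forall>u\<in>U. \<forall>c\<in>C - U. (u, c) \<in> E \<longrightarrow> c \<in> W x"
      using U unfolding is_component_def by blast
    moreover obtain S where "is_component R (I - {x}) S" "\<forall>u\<in>U. {i\<in>I. u \<in> W i} \<subseteq> S"
      using nodes_in_one_component[OF symR dec Uc(1) _ Uc(3)] Uc CV by blast
    ultimately show ?thesis unfolding points_def by blast
  qed
  define good where "good p \<longleftrightarrow> fst p \<in> I \<and> (\<exists>U. points (fst p) (snd p) U)" for p
  obtain i where "i \<in> I" using conI unfolding connected_in_def by blast
  then have "\<exists>p. good p" using ex unfolding good_def by fastforce
  then obtain p where p: "good p" and min: "\<And>q. good q \<Longrightarrow> card (snd p) \<le> card (snd q)"
    using ex_has_least_nat[of good _ "\<lambda>p. card (snd p)"] by blast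
  obtain x S where "p = (x, S)" by (cases p)
  then obtain U where x: "x \<in> I" and U: "points x S U" using p unfolding good_def by auto
  have S: "is_component R (I - {x}) S" using U unfolding points_def by blast
  obtain y where y: "y \<in> S" "(x, y) \<in> R" using component_neighbour[OF tree x S] by blast
  have yI: "y \<in> I" using y S unfolding is_component_def by blast
  obtain S' D where D: "points y S' D" using ex[OF yI] by blast
  have S': "is_component R (I - {y}) S'" using D unfolding points_def by blast
  have "x \<in> S'"
  proof (rule ccontr)
    \<comment> \<open>Otherwise \<open>S'\<close> together with \<open>y\<close> is a connected set
      avoiding \<open>x\<close>, so \<open>S'\<close> is a proper subset of \<open>S\<close>,
      against minimality.\<close>
    assume xS': "x \<notin> S'"
    obtain w where w: "w \<in> S'" "(y, w) \<in> R" using component_neighbour[OF tree yI S'] by blast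
    have "connected_in R (S' \<union> {y})"
      using connected_in_Un[OF symR, of S' "{y}"] w S' connected_in_singleton[of R y] symR
      unfolding is_component_def touches_def by (auto dest: symD)
    moreover have "S' \<union> {y} \<subseteq> I - {x}"
      using xS' S' S yI y unfolding is_component_def by blast
    ultimately have "S' \<union> {y} \<subseteq> S"
      using component_superset[OF symR S] y by blast
    moreover have "y \<notin> S'" using S' unfolding is_component_def by blast
    ultimately have "S' \<subset> S" by blast
    moreover have "finite S" using S finI unfolding is_component_def by (meson finite_Diff finite_subset)
    ultimately have "card S' < card S" by (rule psubset_card_mono[rotated])
    moreover have "good (y, S')" using D yI unfolding good_def by auto
    ultimately show False using min[of "(y, S')"] \<open>p = (x, S)\<close> by simp
  qed
  then have "S \<inter> S' = {}"
    using tree_like_components_disjoint[OF tree x y(1) S S' y(2)] by blast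
  have "U \<inter> D = {}"
  proof (rule ccontr)
    assume "U \<inter> D \<noteq> {}"
    then obtain u where u: "u \<in> U" "u \<in> D" by blast
    then have "u \<in> V" using U CV unfolding points_def full_def by blast
    then obtain i where "i \<in> I" "u \<in> W i"
      using dec unfolding decomposes_def connected_in_def by blast
    then have "i \<in> S" "i \<in> S'" using U D u unfolding points_def by blast+
    then show False using \<open>S \<inter> S' = {}\<close> by blast
  qed
  then show "\<exists>x\<in>I. \<exists>U D. full E Q A C U \<and> full E Q A C D \<and> U \<inter> D = {} \<and>
       (\<forall>u\<in>U. \<forall>c\<in>C - U. (u, c) \<in> E \<longrightarrow> c \<in> W x)"
    using x U D unfolding points_def by blast
qed

lemma part_exists:
  assumes "sym E" and "tree_like R I" and "decomposes V E R I W" and "C \<subseteq> V" "finite C"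
    and model: "is_model E Q A"
    and disj: "\<And>j. j \<in> Q \<Longrightarrow> A j \<inter> C = {}"
    and touch: "\<And>j. j \<in> Q \<Longrightarrow> touches E (A j) C"
    and C: "connected_in E C"
  shows "\<exists>X\<subseteq>C. X \<noteq> {} \<and> (\<exists>x\<in>I. X \<subseteq> W x) \<and>
    (\<forall>C'. is_component E (C - X) C' \<longrightarrow> (\<exists>B. B \<subseteq> C \<union> (\<Union>j\<in>Q. A j) \<and> extends_model E Q A X C' B))"
  using bag_hits_or_disjoint[OF assms(1-4), of Q A]
proof (elim disjE bexE exE conjE)
  fix x assume x: "x \<in> I" and hit: "\<forall>D. full E Q A C D \<longrightarrow> D \<inter> W x \<noteq> {}"
  have "full E Q A C C" using touch C unfolding full_def by blast
  from part_if_hit[OF assms(1,5) model disj this, of "W x"] hit x show ?thesis by metis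
next
  fix x U D assume x: "x \<in> I" and U: "full E Q A C U" and D: "full E Q A C D"
    and UD: "U \<inter> D = {}" and nb: "\<forall>u\<in>U. \<forall>c\<in>C - U. (u, c) \<in> E \<longrightarrow> c \<in> W x"
  from part_if_disjoint[OF assms(1) disj C U D UD, of "W x"] nb x show ?thesis by metis
qed

section \<open>Partitions into subsets of bags\<close>

text \<open>\<open>Qs i\<close> holds the neighbours of the vertex \<open>i\<close> of \<open>H\<close> that precede it; the node \<open>i\<close> of the
  tree-decomposition has the bag \<open>insert i (Qs i)\<close> and hangs below a node \<open>j\<close> as in the definition.\<close>

definition elimination_order :: "nat \<Rightarrow> nat \<Rightarrow> (nat \<Rightarrow> nat set) \<Rightarrow> bool" where
  "elimination_order k N Qs \<longleftrightarrow> (\<forall>i<N. Qs i \<subseteq> {..<i} \<and> card (Qs i) \<le> k \<and>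
     (0 < i \<longrightarrow> (\<exists>j<i. Qs i \<subseteq> insert j (Qs j))))"

text \<open>Adjacency of parts only implies membership in \<open>Qs\<close>: the graph
  \<open>H\<close> may have more edges than the quotient. Parts may be empty.\<close>

definition partial_partition ::
  "'a set \<Rightarrow> 'a rel \<Rightarrow> 'a set set \<Rightarrow> nat \<Rightarrow> (nat \<Rightarrow> 'a set) \<Rightarrow> (nat \<Rightarrow> nat set) \<Rightarrow> bool" where
  "partial_partition V E \<B> N X Qs \<longleftrightarrow>
     (\<forall>i<N. X i \<subseteq> V \<and> (\<exists>B\<in>\<B>. X i \<subseteq> B)) \<and>
     (\<forall>j<N. \<forall>i<j. X i \<inter> X j = {} \<and> (touches E (X i) (X j) \<longrightarrow> i \<in> Qs j))"

text \<open>It is the branch set \<open>A i\<close>, not the part \<open>X i\<close>, that must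
  touch \<open>C\<close>: this keeps \<open>C\<close> available as a further branch set.\<close>

definition anchored ::
  "'a set \<Rightarrow> 'a rel \<Rightarrow> (nat \<Rightarrow> 'a set) \<Rightarrow> nat set \<Rightarrow> (nat \<Rightarrow> 'a set) \<Rightarrow> 'a set \<Rightarrow> bool" where
  "anchored V E X Q A C \<longleftrightarrow> is_model E Q A \<and>
     (\<forall>i\<in>Q. X i \<subseteq> A i \<and> A i \<subseteq> V \<and> A i \<inter> C = {} \<and> touches E (A i) C) \<and>
     (\<forall>c\<in>C. \<forall>w\<in>V. (c, w) \<in> E \<longrightarrow> w \<in> C \<or> (\<exists>i\<in>Q. w \<in> X i))"

text \<open>\<open>B\<close> is added at the index \<open>N\<close>, and every index whose branch
  set does not touch \<open>C'\<close> is discarded. An index whose part contains a neighbour of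
  \<open>C'\<close> survives, because the branch set contains the part.\<close>

lemma anchored_component:
  assumes symE: "sym E" and anch: "anchored V E X Q A C" and N: "N \<notin> Q" and CV: "C \<subseteq> V"
    and C': "is_component E (C - Y) C'"
    and B: "B \<subseteq> C \<union> (\<Union>j\<in>Q. A j)" "extends_model E Q A Y C' B"
  shows "\<exists>Q'\<subseteq>insert N Q. \<exists>A'. anchored V E (X(N := Y)) Q' A' C'"
proof -
  define A' where "A' = A(N := B)"
  define Q' where "Q' = {j \<in> insert N Q. touches E (A' j) C'}"
  have model: "is_model E Q A" using anch unfolding anchored_def by blast
  have Bp: "connected_in E B" "Y \<subseteq> B" "B \<inter> C' = {}"
    "\<And>j. j \<in> Q \<Longrightarrow> touches E (A j) C' \<Longrightarrow> B \<inter> A j = {} \<and> touches E B (A j)"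
    using B unfolding extends_model_def by auto
  have C'C: "C' \<subseteq> C" using C' unfolding is_component_def by blast
  have old: "j \<in> Q' \<Longrightarrow> j \<noteq> N \<Longrightarrow> j \<in> Q \<and> A' j = A j \<and> touches E (A j) C'" for j
    unfolding Q'_def A'_def by auto
  have "is_model E Q' A'"
    unfolding is_model_def
  proof (intro conjI ballI impI)
    fix j assume "j \<in> Q'"
    then show "connected_in E (A' j)"
      using old[of j] Bp(1) model unfolding is_model_def A'_def by (cases "j = N") auto
  next
    fix i j assume ij: "i \<in> Q'" "j \<in> Q'" "i \<noteq> j"
    have "A' i \<inter> A' j = {} \<and> touches E (A' i) (A' j)"
    proof (cases "i = N \<or> j = N")
      case True
      then show ?thesis
      proof
        assume "i = N"
        then show ?thesis using old[of j] Bp(4)[of j] ij unfolding A'_def by auto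
      next
        assume "j = N"
        then show ?thesis using old[of i] Bp(4)[of i] ij touches_sym[OF symE, of B "A i"]
          unfolding A'_def by auto
      qed
    next
      case False
      then show ?thesis using old[of i] old[of j] ij model unfolding is_model_def by auto
    qed
    then show "A' i \<inter> A' j = {}" "touches E (A' i) (A' j)" by auto
  qed
  moreover have "(X(N := Y)) i \<subseteq> A' i \<and> A' i \<subseteq> V \<and> A' i \<inter> C' = {} \<and> touches E (A' i) C'"
    if i: "i \<in> Q'" for i
  proof (cases "i = N")
    case True
    have "B \<subseteq> V" using B(1) CV anch unfolding anchored_def by blast
    then show ?thesis using True Bp i unfolding A'_def Q'_def by auto
  next
    case False
    then show ?thesis using old[OF i] anch C'C unfolding anchored_def by auto
  qed
  moreover have "w \<in> C' \<or> (\<exists>i\<in>Q'. w \<in> (X(N := Y)) i)"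
    if cw: "c \<in> C'" "w \<in> V" "(c, w) \<in> E" for c w
  proof (cases "w \<in> C")
    case True
    show ?thesis
    proof (cases "w \<in> Y")
      case True
      then have "touches E B C'"
        using cw Bp(2) symE unfolding touches_def by (meson subsetD symD)
      then show ?thesis using True unfolding Q'_def A'_def by auto
    next
      case False
      then show ?thesis using True C' cw unfolding is_component_def by blast
    qed
  next
    case False
    then obtain i where i: "i \<in> Q" "w \<in> X i" "w \<in> A i"
      using anch cw C'C unfolding anchored_def by blast
    then have "touches E (A i) C'" using cw symE unfolding touches_def by (meson symD)
    then show ?thesis using i N unfolding Q'_def A'_def by (intro disjI2 bexI[of _ i]) auto
  qed
  ultimately have "anchored V E (X(N := Y)) Q' A' C'" unfolding anchored_def by blast
  moreover have "Q' \<subseteq> insert N Q" unfolding Q'_def by blast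
  ultimately show ?thesis by blast
qed

lemma anchored_cong:
  assumes "anchored V E X Q A C" "\<And>i. i \<in> Q \<Longrightarrow> X' i = X i"
  shows "anchored V E X' Q A C"
proof -
  have "(\<exists>i\<in>Q. w \<in> X' i) \<longleftrightarrow> (\<exists>i\<in>Q. w \<in> X i)" for w using assms(2) by blast
  then show ?thesis using assms(1) unfolding anchored_def by (simp add: assms(2))
qed

text \<open>Since \<open>Q\<close> lies in the bag \<open>insert j (Qs j)\<close> of an existing
  node, a part chosen inside \<open>C\<close> can become a new node below \<open>j\<close>.\<close>

definition partition_state ::
  "'a set \<Rightarrow> 'a rel \<Rightarrow> 'a set set \<Rightarrow> nat \<Rightarrow> nat \<Rightarrow> (nat \<Rightarrow> 'a set) \<Rightarrow> (nat \<Rightarrow> nat set) \<Rightarrow> bool" where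
  "partition_state V E \<B> k N X Qs \<longleftrightarrow>
     0 < N \<and> elimination_order k N Qs \<and> partial_partition V E \<B> N X Qs \<and>
     (\<forall>C. is_component E (V - (\<Union>i<N. X i)) C \<longrightarrow>
       (\<exists>Q A j. j < N \<and> Q \<subseteq> insert j (Qs j) \<and> anchored V E X Q A C))"

lemma extend_partition_state:
  assumes symE: "sym E" and tree: "tree_like R I" and dec: "decomposes V E R I W" and finV: "finite V"
    and no_model: "\<forall>Q A. is_model E (Q :: nat set) A \<and> finite Q \<and> (\<forall>j\<in>Q. A j \<subseteq> V) \<longrightarrow> card Q \<le> Suc k"
    and state: "partition_state V E (W ` I) k N X Qs"
    and ne: "V - (\<Union>i<N. X i) \<noteq> {}"
  shows "\<exists>X' Qs'. partition_state V E (W ` I) k (Suc N) X' Qs' \<and>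
    V - (\<Union>i<Suc N. X' i) \<subset> V - (\<Union>i<N. X i)"
proof -
  let ?S = "V - (\<Union>i<N. X i)"
  have order: "elimination_order k N Qs" and part: "partial_partition V E (W ` I) N X Qs"
    and anch: "\<And>C. is_component E ?S C \<Longrightarrow>
      \<exists>Q A j. j < N \<and> Q \<subseteq> insert j (Qs j) \<and> anchored V E X Q A C"
    using state unfolding partition_state_def by simp_all
  obtain v where "v \<in> ?S" using ne by blast
  then obtain C where C: "is_component E ?S C"
    by (meson component_containing[OF symE])
  obtain Q A j where j: "j < N" "Q \<subseteq> insert j (Qs j)" and st: "anchored V E X Q A C"
    using anch[OF C] by blast
  have CS: "C \<subseteq> ?S" "connected_in E C" using C unfolding is_component_def by auto
  have CV: "C \<subseteq> V" using CS by blast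
  have Qj: "Qs j \<subseteq> {..<j}" using order j unfolding elimination_order_def by blast
  have QN: "Q \<subseteq> {..<N}" using j Qj by fastforce
  then have N: "N \<notin> Q" and finQ: "finite Q" by (auto intro: finite_subset)
  have stp: "is_model E Q A"
    "\<And>i. i \<in> Q \<Longrightarrow> X i \<subseteq> A i \<and> A i \<subseteq> V \<and> A i \<inter> C = {} \<and> touches E (A i) C"
    "\<And>c w. c \<in> C \<Longrightarrow> w \<in> V \<Longrightarrow> (c, w) \<in> E \<Longrightarrow> w \<in> C \<or> (\<exists>i\<in>Q. w \<in> X i)"
    using st unfolding anchored_def by auto
  \<comment> \<open>\<open>C\<close> serves as one more branch set, so the bound
    \<open>Suc k\<close> on models leaves at most \<open>k\<close> indices in
    \<open>Q\<close>.\<close>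
  have "is_model E (insert N Q) (A(N := C))"
    using stp(1,2) N CS(2) touches_sym[OF symE, of _ C] unfolding is_model_def
    by (auto simp: Int_commute)
  then have "card (insert N Q) \<le> Suc k"
    by (rule no_model[rule_format, OF conjI]) (use stp(2) finQ CV N in auto)
  then have cardQ: "card Q \<le> k" using N finQ by simp
  obtain Y where Y: "Y \<subseteq> C" "Y \<noteq> {}" "\<exists>x\<in>I. Y \<subseteq> W x"
    and ext: "\<And>C'. is_component E (C - Y) C' \<Longrightarrow>
      \<exists>B. B \<subseteq> C \<union> (\<Union>j\<in>Q. A j) \<and> extends_model E Q A Y C' B"
    using part_exists[OF symE tree dec CV finite_subset[OF CV finV] stp(1) _ _ CS(2)] stp(2)
    by metis
  define X' where "X' = X(N := Y)"
  define Qs' where "Qs' = Qs(N := Q)"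
  have S': "V - (\<Union>i<Suc N. X' i) = ?S - Y"
    unfolding X'_def by (auto simp: lessThan_Suc)
  have "elimination_order k (Suc N) Qs'"
    unfolding elimination_order_def
  proof (intro allI impI)
    fix i assume i: "i < Suc N"
    show "Qs' i \<subseteq> {..<i} \<and> card (Qs' i) \<le> k \<and> (0 < i \<longrightarrow> (\<exists>j<i. Qs' i \<subseteq> insert j (Qs' j)))"
    proof (cases "i = N")
      case True
      then show ?thesis using QN cardQ j unfolding Qs'_def by auto
    next
      case False
      then have "i < N" using i by simp
      then have "Qs i \<subseteq> {..<i} \<and> card (Qs i) \<le> k \<and> (0 < i \<longrightarrow> (\<exists>j<i. Qs i \<subseteq> insert j (Qs j)))"
        using order unfolding elimination_order_def by blast
      then show ?thesis using \<open>i < N\<close> unfolding Qs'_def by fastforce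
    qed
  qed
  moreover have "partial_partition V E (W ` I) (Suc N) X' Qs'"
    unfolding partial_partition_def
  proof (intro conjI allI impI)
    fix i assume "i < Suc N"
    then show "X' i \<subseteq> V" "\<exists>B\<in>W ` I. X' i \<subseteq> B"
      using part Y CV unfolding partial_partition_def X'_def by (auto simp: less_Suc_eq)
  next
    fix i l assume l: "l < Suc N" "i < l"
    have "X' i \<inter> X' l = {} \<and> (touches E (X' i) (X' l) \<longrightarrow> i \<in> Qs' l)"
    proof (cases "l = N")
      case True
      then have iN: "i < N" using l by simp
      then have disj: "X i \<inter> C = {}" using CS by blast
      have "i \<in> Q" if touch: "touches E (X i) Y"
      proof -
        obtain a c where ac: "a \<in> X i" "c \<in> C" "(c, a) \<in> E"
          using touch Y symE unfolding touches_def by (meson subsetD symD)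
        moreover have "a \<in> V" using ac iN part unfolding partial_partition_def by blast
        ultimately obtain i' where i': "i' \<in> Q" "a \<in> X i'" using stp(3) disj by blast
        then have "i' < N" using QN by blast
        then have "i' = i"
          using i' ac iN part unfolding partial_partition_def by (metis disjoint_iff nat_neq_iff)
        then show ?thesis using i' by blast
      qed
      then show ?thesis using True iN disj Y unfolding X'_def Qs'_def by auto
    next
      case False
      then have "l < N" "i < N" using l by auto
      then show ?thesis using part l unfolding partial_partition_def X'_def Qs'_def by auto
    qed
    then show "X' i \<inter> X' l = {}" "touches E (X' i) (X' l) \<Longrightarrow> i \<in> Qs' l" by auto
  qed
  moreover have "\<exists>Q A j. j < Suc N \<and> Q \<subseteq> insert j (Qs' j) \<and> anchored V E X' Q A C'"
    if comp': "is_component E (V - (\<Union>i<Suc N. X' i)) C'" for C'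
  proof (cases "C' \<inter> C = {}")
    case True
    have C': "connected_in E C'" "C' \<subseteq> ?S - Y"
      "\<And>b c. b \<in> C' \<Longrightarrow> c \<in> ?S - Y \<Longrightarrow> (b, c) \<in> E \<Longrightarrow> c \<in> C'"
      using comp' unfolding S' is_component_def by auto
    \<comment> \<open>No arc of the old remainder leads from outside \<open>C\<close> into
      \<open>C\<close>, so a component avoiding \<open>C\<close> was a component before and keeps
      its anchors.\<close>
    have "is_component E ?S C'"
      unfolding is_component_def
    proof (intro conjI ballI impI)
      fix b c assume bc: "b \<in> C'" "c \<in> ?S" "(b, c) \<in> E"
      have "b \<in> ?S" "b \<notin> C" using C'(2) bc(1) True by auto
      then have "c \<notin> C" using C bc(3) symE unfolding is_component_def by (meson symD)
      then show "c \<in> C'" using C'(3)[OF bc(1) _ bc(3)] Y(1) bc(2) by auto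
    qed (use C' in auto)
    then obtain Q0 A0 j0 where 0: "j0 < N" "Q0 \<subseteq> insert j0 (Qs j0)" "anchored V E X Q0 A0 C'"
      using anch by meson
    moreover have "Qs j0 \<subseteq> {..<j0}" using order 0 unfolding elimination_order_def by blast
    then have "Q0 \<subseteq> {..<N}" using 0 by fastforce
    then have "anchored V E X' Q0 A0 C'"
      by (intro anchored_cong[OF 0(3)]) (auto simp: X'_def)
    ultimately show ?thesis unfolding Qs'_def
      by (intro exI[of _ Q0] exI[of _ A0] exI[of _ j0]) auto
  next
    case False
    have C': "connected_in E C'" "C' \<subseteq> ?S - Y"
      "\<And>b c. b \<in> C' \<Longrightarrow> c \<in> ?S - Y \<Longrightarrow> (b, c) \<in> E \<Longrightarrow> c \<in> C'"
      using comp' unfolding S' is_component_def by auto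
    have "C' \<subseteq> C"
      by (rule component_superset[OF symE C C'(1)]) (use C'(2) False in auto)
    moreover have "c \<in> C'" if "b \<in> C'" "c \<in> C - Y" "(b, c) \<in> E" for b c
      by (rule C'(3)[OF that(1) _ that(3)]) (use that(2) CS(1) in auto)
    ultimately have C'C: "is_component E (C - Y) C'"
      using C'(1,2) unfolding is_component_def by blast
    obtain B where "B \<subseteq> C \<union> (\<Union>j\<in>Q. A j)" "extends_model E Q A Y C' B"
      using ext[OF C'C] by blast
    from anchored_component[OF symE st N CV C'C this]
    obtain Q' A' where "Q' \<subseteq> insert N Q" "anchored V E X' Q' A' C'" unfolding X'_def by blast
    then show ?thesis unfolding Qs'_def
      by (intro exI[of _ Q'] exI[of _ A'] exI[of _ N]) auto
  qed
  moreover have "V - (\<Union>i<Suc N. X' i) \<subset> ?S" unfolding S' using Y CS by blast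
  ultimately show ?thesis
    unfolding partition_state_def by (intro exI[of _ X'] exI[of _ Qs']) simp
qed

text \<open>The number of uncovered vertices drops with every extension, and a state with nothing
  uncovered is the partition sought.\<close>

lemma bag_partition_exists:
  assumes symE: "sym E" and tree: "tree_like R I" and dec: "decomposes V E R I W" and finV: "finite V"
    and no_model: "\<forall>Q A. is_model E (Q :: nat set) A \<and> finite Q \<and> (\<forall>j\<in>Q. A j \<subseteq> V) \<longrightarrow> card Q \<le> Suc k"
  shows "\<exists>N X Qs. 0 < N \<and> elimination_order k N Qs \<and> partial_partition V E (W ` I) N X Qs \<and>
    V = (\<Union>i<N. X i)"
proof -
  let ?P = "partition_state V E (W ` I) k"
  have "\<exists>N X Qs. ?P N X Qs \<and> V - (\<Union>i<N. X i) = {}" if "?P N X Qs" for N X Qs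
    using that
  proof (induction "card (V - (\<Union>i<N. X i))" arbitrary: N X Qs rule: less_induct)
    case less
    show ?case
    proof (cases "V - (\<Union>i<N. X i) = {}")
      case False
      obtain X' Qs' where *: "?P (Suc N) X' Qs'"
        "V - (\<Union>i<Suc N. X' i) \<subset> V - (\<Union>i<N. X i)"
        using extend_partition_state[OF symE tree dec finV no_model less.prems False] by metis
      have "card (V - (\<Union>i<Suc N. X' i)) < card (V - (\<Union>i<N. X i))"
        by (rule psubset_card_mono[OF _ *(2)]) (use finV in simp)
      from less.hyps[OF this *(1)] show ?thesis .
    next
      case True
      then show ?thesis using less.prems by metis
    qed
  qed
  \<comment> \<open>An empty part at index \<open>0\<close> serves as the root, so that \<open>H\<close> is never null.\<close>
  moreover have "?P 1 (\<lambda>_. {}) (\<lambda>_. {})"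
  proof -
    \<comment> \<open>Some bag has to exist in order to contain the empty part.\<close>
    have "I \<noteq> {}" using tree unfolding tree_like_def connected_in_def by blast
    moreover have "anchored V E (\<lambda>_. {}) {} (\<lambda>_. {}) C" if "is_component E V C" for C
      using that unfolding anchored_def is_component_def is_model_def by blast
    ultimately show ?thesis
      unfolding partition_state_def elimination_order_def partial_partition_def by auto
  qed
  ultimately obtain N X Qs where st: "?P N X Qs" and "V - (\<Union>i<N. X i) = {}" by metis
  moreover have "(\<Union>i<N. X i) \<subseteq> V" using st unfolding partition_state_def partial_partition_def by blast
  ultimately have "V = (\<Union>i<N. X i)" by blast
  then show ?thesis using st unfolding partition_state_def by metis
qed

section \<open>Trees and treewidth\<close>

lemma strongly_connected_iff_connected_in:
  assumes "parcs G \<subseteq> pverts G \<times> pverts G"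
  shows "strongly_connected (with_proj G) \<longleftrightarrow> connected_in (parcs G) (pverts G)"
proof -
  have "parcs G \<inter> pverts G \<times> pverts G = parcs G" using assms by blast
  moreover have "(a, b) \<in> rtrancl_on (pverts G) (parcs G) \<longleftrightarrow> (a, b) \<in> (parcs G)\<^sup>*"
    if "a \<in> pverts G" "b \<in> pverts G" for a b
  proof
    assume "(a, b) \<in> (parcs G)\<^sup>*"
    then show "(a, b) \<in> rtrancl_on (pverts G) (parcs G)"
      by (rule rtrancl_consistent_rtrancl_on) (use that assms in auto)
  qed (rule rtrancl_on_rtranclI)
  ultimately show ?thesis
    unfolding strongly_connected_def connected_in_def reachable_def with_proj_simps by auto
qed

lemma connected_restrict_iff:
  assumes "sym (parcs T)"
  shows "Digraph_Component.connected (with_proj T \<restriction> S) \<longleftrightarrow> connected_in (parcs T) S"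
proof -
  have "mk_symmetric (with_proj T \<restriction> S) = \<lparr>pverts = S, parcs = parcs T \<inter> S \<times> S\<rparr>"
    using assms unfolding mk_symmetric_def by (auto simp: induce_subgraph_def dest: symD)
  moreover have "connected_in (parcs T \<inter> S \<times> S) S \<longleftrightarrow> connected_in (parcs T) S"
    unfolding connected_in_def by (simp add: Int_assoc)
  ultimately show ?thesis
    unfolding Digraph_Component.connected_def
    by (simp add: strongly_connected_iff_connected_in)
qed

lemma connected_iff_connected_in:
  assumes "pair_graph T"
  shows "Digraph_Component.connected (with_proj T) \<longleftrightarrow> connected_in (parcs T) (pverts T)"
proof -
  interpret pair_graph T by fact
  have "mk_symmetric (with_proj T) = \<lparr>pverts = pverts T, parcs = parcs T\<rparr>"
    unfolding mk_symmetric_def by (auto dest: arcs_symmetric)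
  then show ?thesis
    unfolding Digraph_Component.connected_def
    using in_arcsD1 in_arcsD2 by (simp add: strongly_connected_iff_connected_in subset_iff)
qed

lemma pair_graph_sym:
  assumes "pair_graph G"
  shows "sym (parcs G)"
proof -
  interpret pair_graph G by fact
  show ?thesis by (rule symI) (rule arcs_symmetric)
qed

lemma pawalk_verts_pcas: "pcas u p v \<Longrightarrow> pawalk_verts u p = u # map snd p"
  by (induction p arbitrary: u) auto

lemma cycle_with_proj_iff:
  "pre_digraph.cycle (with_proj T) p \<longleftrightarrow>
     (\<exists>u\<in>pverts T. set p \<subseteq> parcs T \<and> pcas u p u \<and> distinct (map snd p) \<and> p \<noteq> [])"
  unfolding pre_digraph.cycle_def pre_digraph.awalk_def
  by (auto simp: cas_with_proj_eq awalk_verts_with_proj_eq pawalk_verts_pcas)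

text \<open>A path inside \<open>D\<close> between two distinct neighbours of \<open>y\<close>
  closes up through \<open>y\<close> to a cycle with at least three arcs.\<close>

lemma tree_like_if_is_tree:
  assumes "is_tree T"
  shows "tree_like (parcs T) (pverts T)"
proof -
  have T: "pair_graph T" using assms unfolding is_tree_def by blast
  interpret pair_graph T by fact
  have "w = x" if yw: "(y, w) \<in> parcs T" and yx: "(y, x) \<in> parcs T" and D: "D \<subseteq> pverts T - {y}"
    and conn: "connected_in (parcs T) D" and wD: "w \<in> D" and xD: "x \<in> D" for x y w D
  proof (rule ccontr)
    assume "w \<noteq> x"
    define T' where "T' = \<lparr>pverts = D, parcs = parcs T \<inter> D \<times> D\<rparr>"
    interpret T': pair_wf_digraph T' by unfold_locales (auto simp: T'_def)
    have "connected_in (parcs T') (pverts T')"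
      using conn unfolding T'_def connected_in_def by (simp add: Int_assoc)
    then have "strongly_connected (with_proj T')"
      using strongly_connected_iff_connected_in[of T'] by (simp add: T'_def)
    then have "w \<rightarrow>\<^sup>*\<^bsub>with_proj T'\<^esub> x"
      using wD xD unfolding strongly_connected_def by (simp add: T'_def)
    then obtain p where "T'.apath w p x" using T'.reachable_apath by blast
    then have p: "set p \<subseteq> parcs T \<inter> D \<times> D" "pcas w p x" "distinct (pawalk_verts w p)"
      unfolding T'.apath_def T'.awalk_def by (auto simp: T'_def)
    have "p \<noteq> []" using p(2) \<open>w \<noteq> x\<close> by auto
    let ?c = "(y, w) # p @ [(x, y)]"
    have "distinct (map snd ?c)"
      using p(1,3) D wD unfolding pawalk_verts_pcas[OF p(2)] by auto
    moreover have "pcas y ?c y"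
    proof -
      have "pcas w (p @ [(x, y)]) y" using p(2) by (induction p arbitrary: w) auto
      then show ?thesis by simp
    qed
    moreover have "set ?c \<subseteq> parcs T" using p yw yx arcs_symmetric by auto
    moreover have "y \<in> pverts T" using yw in_arcsD1 by blast
    ultimately have "pre_digraph.cycle (with_proj T) ?c"
      unfolding cycle_with_proj_iff by blast
    moreover have "3 \<le> length ?c" using \<open>p \<noteq> []\<close> by (cases p) auto
    ultimately show False using assms unfolding is_tree_def by blast
  qed
  moreover have "connected_in (parcs T) (pverts T)"
    using assms connected_iff_connected_in[OF T] unfolding is_tree_def by blast
  ultimately show ?thesis
    unfolding tree_like_def using pair_graph_sym[OF T] pair_finite_verts by blast
qed

lemma decomposes_if_tree_decomposition:
  assumes "tree_decomposition G T W"
  shows "decomposes (pverts G) (parcs G) (parcs T) (pverts T) W"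
proof -
  have "sym (parcs T)"
    using assms pair_graph_sym unfolding tree_decomposition_def is_tree_def by blast
  then show ?thesis
    using assms unfolding tree_decomposition_def decomposes_def
    by (auto simp: connected_restrict_iff)
qed

section \<open>Trees from parent functions and elimination orders\<close>

definition parent_tree :: "nat \<Rightarrow> (nat \<Rightarrow> nat) \<Rightarrow> nat pair_pre_digraph" where
  "parent_tree N par = \<lparr>pverts = {..<N},
     parcs = {(i, j). i < N \<and> j < N \<and> (0 < i \<and> j = par i \<or> 0 < j \<and> i = par j)}\<rparr>"

text \<open>In a set avoiding the root \<open>r\<close>, the parent of the least element is smaller
  and hence outside, which gives the crossing arc. The root is \<open>0\<close> for the whole tree
  and \<open>v\<close> for the nodes whose bags contain \<open>v\<close>.\<close>

lemma connected_in_parent_closed: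
  fixes S :: "nat set"
  assumes "sym E" "r \<in> S"
    and par: "\<And>i. i \<in> S \<Longrightarrow> i \<noteq> r \<Longrightarrow> par i < i \<and> par i \<in> S \<and> (i, par i) \<in> E"
  shows "connected_in E S"
proof (rule connected_inI_cut)
  fix B assume B: "B \<subseteq> S" "B \<noteq> {}" "B \<noteq> S"
  have cross: "touches E D (S - D)" if D: "D \<subseteq> S" "D \<noteq> {}" "r \<notin> D" for D
  proof -
    define i where "i = (LEAST i. i \<in> D)"
    have i: "i \<in> D" unfolding i_def using D by (metis LeastI ex_in_conv)
    then have *: "par i < i" "par i \<in> S" "(i, par i) \<in> E" using par D by blast+
    then have "par i \<notin> D" unfolding i_def using not_less_Least by blast
    then show ?thesis using i * unfolding touches_def by blast
  qed
  show "touches E B (S - B)"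
  proof (cases "r \<in> B")
    case True
    then have "touches E (S - B) (S - (S - B))" using cross[of "S - B"] B by blast
    moreover have "S - (S - B) = B" using B by blast
    ultimately show ?thesis using touches_sym[OF assms(1)] by metis
  qed (use cross B in blast)
qed (use assms in blast)

lemma pcas_nth_Suc: "pcas u p v \<Longrightarrow> Suc i < length p \<Longrightarrow> fst (p ! Suc i) = snd (p ! i)"
proof (induction p arbitrary: u i)
  case (Cons e p)
  then show ?case by (cases p; cases i) auto
qed simp

lemma pcas_ends: "pcas u p v \<Longrightarrow> p \<noteq> [] \<Longrightarrow> fst (p ! 0) = u \<and> snd (p ! (length p - 1)) = v"
proof (induction p arbitrary: u)
  case (Cons e p)
  then show ?case by (cases p) auto
qed simp

text \<open>The predecessor and the successor of the largest vertex \<open>m\<close> on a cycle are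
  both \<open>par m\<close>. As the heads on the cycle are distinct, the two positions coincide,
  which a length of at least three excludes.\<close>

lemma is_tree_parent_tree:
  assumes "0 < N" and par: "\<And>i. 0 < i \<Longrightarrow> i < N \<Longrightarrow> par i < i"
  shows "is_tree (parent_tree N par)"
proof -
  let ?T = "parent_tree N par"
  have T: "pair_graph ?T"
  proof
    have "parcs ?T \<subseteq> {..<N} \<times> {..<N}" by (auto simp: parent_tree_def)
    then show "finite (parcs ?T)" by (rule finite_subset) simp
    show "symmetric (with_proj ?T)" by (auto simp: symmetric_def sym_def parent_tree_def)
    show "fst e \<noteq> snd e" if "e \<in> parcs ?T" for e
      using that par[of "fst e"] par[of "snd e"] by (auto simp: parent_tree_def)
  qed (auto simp: parent_tree_def)
  moreover have "connected_in (parcs ?T) (pverts ?T)"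
  proof (rule connected_in_parent_closed[of _ 0 _ par])
    show "par i < i \<and> par i \<in> pverts ?T \<and> (i, par i) \<in> parcs ?T" if "i \<in> pverts ?T" "i \<noteq> 0" for i
      using that par[of i] by (auto simp: parent_tree_def)
  qed (use pair_graph_sym[OF T] assms(1) in \<open>auto simp: parent_tree_def\<close>)
  moreover have False if cyc: "pre_digraph.cycle (with_proj ?T) p" and L3: "3 \<le> length p" for p
  proof -
    obtain u where p: "set p \<subseteq> parcs ?T" "pcas u p u" "distinct (map snd p)" "p \<noteq> []"
      using cyc unfolding cycle_with_proj_iff by blast
    let ?L = "length p"
    define m where "m = Max (snd ` set p)"
    have "m \<in> snd ` set p" unfolding m_def using p(4) by (intro Max_in) auto
    then obtain i where i: "i < ?L" "snd (p ! i) = m" by (auto simp: in_set_conv_nth)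
    \<comment> \<open>\<open>s\<close> is the cyclic successor of a position; below,
      \<open>k\<close> is the cyclic predecessor of \<open>i\<close>.\<close>
    define s where "s i = (if Suc i = ?L then 0 else Suc i)" for i
    have next_arc: "s k < ?L" "fst (p ! s k) = snd (p ! k)" if "k < ?L" for k
    proof -
      show "s k < ?L" using that L3 unfolding s_def by auto
      show "fst (p ! s k) = snd (p ! k)"
      proof (cases "Suc k = ?L")
        case True
        then have "k = ?L - 1" by simp
        then show ?thesis using True pcas_ends[OF p(2,4)] unfolding s_def by auto
      next
        case False
        then show ?thesis using pcas_nth_Suc[OF p(2), of k] that unfolding s_def by auto
      qed
    qed
    define k where "k = (if i = 0 then ?L - 1 else i - 1)"
    have k: "k < ?L" "s k = i" using i L3 unfolding k_def s_def by auto
    have le: "snd (p ! l) \<le> m" if "l < ?L" for l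
      unfolding m_def using that by (intro Max_ge) auto
    have par_m: "a = par m" if "(a, m) \<in> parcs ?T \<or> (m, a) \<in> parcs ?T" "a \<le> m" for a
      using that par[of a] par[of m] by (auto simp: parent_tree_def)
    have "p ! i \<in> parcs ?T" using p(1) i(1) by auto
    then have "(snd (p ! k), m) \<in> parcs ?T"
      using next_arc(2)[OF k(1)] k(2) i(2) by (metis prod.collapse)
    then have 1: "snd (p ! k) = par m" using par_m le[OF k(1)] by blast
    have "p ! s i \<in> parcs ?T" using p(1) next_arc(1)[OF i(1)] by auto
    then have "(m, snd (p ! s i)) \<in> parcs ?T"
      using next_arc(2)[OF i(1)] i(2) by (metis prod.collapse)
    then have 2: "snd (p ! s i) = par m" using par_m le[OF next_arc(1)[OF i(1)]] by blast
    have "k = s i"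
      using p(3) 1 2 k(1) next_arc(1)[OF i(1)] nth_eq_iff_index_eq[of "map snd p" k "s i"] by simp
    then show False using i(1) L3 unfolding k_def s_def by (auto split: if_splits)
  qed
  ultimately show ?thesis
    unfolding is_tree_def using connected_iff_connected_in[OF T] by blast
qed

definition elimination_graph :: "nat \<Rightarrow> (nat \<Rightarrow> nat set) \<Rightarrow> nat pair_pre_digraph" where
  "elimination_graph N Qs = \<lparr>pverts = {..<N},
     parcs = {(i, j). i < N \<and> j < N \<and> (i \<in> Qs j \<or> j \<in> Qs i)}\<rparr>"

lemma pair_graph_elimination_graph:
  assumes "elimination_order k N Qs"
  shows "pair_graph (elimination_graph N Qs)"
proof
  have "parcs (elimination_graph N Qs) \<subseteq> {..<N} \<times> {..<N}" by (auto simp: elimination_graph_def)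
  then show "finite (parcs (elimination_graph N Qs))" by (rule finite_subset) simp
  show "symmetric (with_proj (elimination_graph N Qs))"
    by (auto simp: symmetric_def sym_def elimination_graph_def)
  show "fst e \<noteq> snd e" if "e \<in> parcs (elimination_graph N Qs)" for e
    using that assms by (fastforce simp: elimination_graph_def elimination_order_def)
qed (auto simp: elimination_graph_def)

text \<open>The nodes whose bags contain \<open>v\<close> form a subtree rooted at \<open>v\<close>:
  if \<open>v\<close> is in \<open>Qs i\<close>, then the choice of \<open>par\<close> puts
  \<open>v\<close> into the bag of the parent as well. Bags have at most \<open>Suc k\<close>
  elements.\<close>

lemma treewidth_elimination_graph:
  assumes order: "elimination_order k N Qs" and "0 < N"
  shows "treewidth (elimination_graph N Qs) \<le> k"
proof -
  have Qs: "Qs i \<subseteq> {..<i}" "card (Qs i) \<le> k" "0 < i \<Longrightarrow> \<exists>j<i. Qs i \<subseteq> insert j (Qs j)"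
    if "i < N" for i
    using order that unfolding elimination_order_def by blast+
  define par where "par i = (SOME j. j < i \<and> Qs i \<subseteq> insert j (Qs j))" for i
  have par: "par i < i" "Qs i \<subseteq> insert (par i) (Qs (par i))" if "0 < i" "i < N" for i
    using someI_ex[OF Qs(3)[OF that(2,1)]] unfolding par_def by blast+
  let ?T = "parent_tree N par" and ?W = "\<lambda>i. insert i (Qs i)"
  have tree: "is_tree ?T" by (rule is_tree_parent_tree[OF assms(2) par(1)])
  then have symT: "sym (parcs ?T)" using pair_graph_sym unfolding is_tree_def by blast
  have "tree_decomposition (elimination_graph N Qs) ?T ?W"
    unfolding tree_decomposition_def
  proof (intro conjI ballI)
    fix v assume "v \<in> pverts (elimination_graph N Qs)"
    then have v: "v < N" by (simp add: elimination_graph_def)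
    have "connected_in (parcs ?T) {x\<in>pverts ?T. v \<in> ?W x}"
    proof (rule connected_in_parent_closed[OF symT, of v _ par])
      fix i assume i: "i \<in> {x\<in>pverts ?T. v \<in> ?W x}" "i \<noteq> v"
      then have iN: "i < N" and vi: "v \<in> Qs i" by (auto simp: parent_tree_def)
      then have "v < i" using Qs(1) by blast
      then have "0 < i" by simp
      then show "par i < i \<and> par i \<in> {x\<in>pverts ?T. v \<in> ?W x} \<and> (i, par i) \<in> parcs ?T"
        using par[OF _ iN] iN vi by (auto simp: parent_tree_def)
    qed (use v in \<open>auto simp: parent_tree_def\<close>)
    then show "Digraph_Component.connected (with_proj ?T \<restriction> {x\<in>pverts ?T. v \<in> ?W x})"
      by (simp add: connected_restrict_iff[OF symT])
  next
    fix x assume "x \<in> pverts ?T"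
    then show "?W x \<subseteq> pverts (elimination_graph N Qs)"
      using Qs(1)[of x] by (auto simp: parent_tree_def elimination_graph_def)
  qed (use tree in \<open>auto simp: parent_tree_def elimination_graph_def\<close>)
  moreover have "width ?T ?W \<le> k"
  proof -
    have "card (?W i) \<le> Suc k" if "i < N" for i
      using Qs(2)[OF that] card_insert_le_m1[of "Suc k" "Qs i" i] by simp
    then have "Max ((\<lambda>i. card (?W i)) ` pverts ?T) \<le> Suc k"
      using assms(2) by (subst Max_le_iff) (auto simp: parent_tree_def)
    then show ?thesis unfolding width_def by simp
  qed
  ultimately show ?thesis
    unfolding treewidth_def by (intro order.trans[OF Least_le]) auto
qed

section \<open>Complete minors and embeddings\<close>

lemma digraph_iso_image:
  assumes "pair_wf_digraph A" "inj_on g (pverts A)"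
  shows "digraph_iso (with_proj A)
    (with_proj \<lparr>pverts = g ` pverts A, parcs = map_prod g g ` parcs A\<rparr>)"
proof -
  let ?h = "\<lparr>iso_verts = g, iso_arcs = map_prod g g, iso_head = snd, iso_tail = fst\<rparr>"
  interpret pair_wf_digraph A by fact
  have "inj_on (map_prod g g) (parcs A)"
  proof (rule inj_on_subset[OF map_prod_inj_on[OF assms(2,2)]])
    show "parcs A \<subseteq> pverts A \<times> pverts A" using in_arcsD1 in_arcsD2 by auto
  qed
  moreover have "wf_digraph (with_proj A)" using assms(1) by (simp add: wf_digraph_wp_iff)
  ultimately have "pre_digraph.digraph_isomorphism (with_proj A) ?h"
    using assms(2) unfolding pre_digraph.digraph_isomorphism_def by auto
  moreover have "with_proj \<lparr>pverts = g ` pverts A, parcs = map_prod g g ` parcs A\<rparr> = app_iso ?h (with_proj A)"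
    by (simp add: app_iso_def with_proj_def)
  ultimately show ?thesis unfolding digraph_iso_def by blast
qed

lemma isomorphic_to_subgraphI:
  assumes G: "pair_graph G" and X: "pair_graph X" and inj: "inj_on g (pverts G)"
    and verts: "\<And>v. v \<in> pverts G \<Longrightarrow> g v \<in> pverts X"
    and arcs: "\<And>v w. (v, w) \<in> parcs G \<Longrightarrow> (g v, g w) \<in> parcs X"
  shows "isomorphic_to_subgraph G X"
proof -
  interpret G: pair_graph G by fact
  interpret X: pair_graph X by fact
  let ?S = "\<lparr>pverts = g ` pverts G, parcs = map_prod g g ` parcs G\<rparr>"
  have S: "pair_graph ?S"
  proof
    show "symmetric (with_proj ?S)"
      unfolding symmetric_def with_proj_simps
      by (rule symI) (auto dest: G.arcs_symmetric intro: rev_image_eqI)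
    show "fst e \<noteq> snd e" if "e \<in> parcs ?S" for e
      using that arcs X.no_loops' by fastforce
  qed (auto dest: G.in_arcsD1 G.in_arcsD2)
  then interpret S: pair_graph ?S .
  have "subgraph (with_proj ?S) (with_proj X)"
    unfolding subgraph_def
    using verts arcs S.wf_digraph_axioms X.wf_digraph_axioms by auto
  moreover have "digraph_iso (with_proj G) (with_proj ?S)"
    by (rule digraph_iso_image[OF G.pair_wf_digraph inj])
  ultimately show ?thesis using S unfolding isomorphic_to_subgraph_def by blast
qed

section \<open>Contracting branch sets to a complete minor\<close>

lemma connected_in_image:
  assumes "connected_in E A"
    and "\<And>a b. a \<in> A \<Longrightarrow> b \<in> A \<Longrightarrow> (a, b) \<in> E \<Longrightarrow> h a \<noteq> h b \<Longrightarrow> (h a, h b) \<in> E'"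
  shows "connected_in E' (h ` A)"
proof (rule connected_inI_cut)
  show "h ` A \<noteq> {}" using assms(1) unfolding connected_in_def by blast
  fix B assume B: "B \<subseteq> h ` A" "B \<noteq> {}" "B \<noteq> h ` A"
  have "touches E {a\<in>A. h a \<in> B} (A - {a\<in>A. h a \<in> B})"
    by (rule connected_in_cut[OF assms(1)]) (use B in auto)
  then obtain a b where "a \<in> A" "b \<in> A" "h a \<in> B" "h b \<notin> B" "(a, b) \<in> E"
    unfolding touches_def by blast
  moreover from this have "h a \<noteq> h b" by metis
  ultimately show "touches E' B (h ` A - B)"
    using assms(2)[of a b] unfolding touches_def by blast
qed

text \<open>Injectivity makes all branch sets singletons, so nothing remains to be contracted; the
  inverse of \<open>f\<close> is the isomorphism.\<close>

lemma complete_graph_if_model: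
  assumes S: "pair_graph S" and "inj_on f (pverts S)" and "f ` pverts S \<subseteq> {..<t}"
    and model: "is_model (parcs S) {..<t} (\<lambda>i. {v\<in>pverts S. f v = i})"
  shows "digraph_iso (with_proj (complete_graph t)) (with_proj S)"
proof -
  interpret S: pair_graph S by fact
  define g where "g = inv_into (pverts S) f"
  have fib: "{v\<in>pverts S. f v = i} \<noteq> {}" if "i < t" for i
    using model that unfolding is_model_def connected_in_def by blast
  then have fS: "f ` pverts S = {..<t}" using assms(3) by blast
  have gf: "g (f v) = v" if "v \<in> pverts S" for v
    unfolding g_def using assms(2) that by simp
  have fg: "f (g i) = i" "g i \<in> pverts S" if "i < t" for i
    using that fS unfolding g_def by (simp_all add: f_inv_into_f inv_into_into)
  have gS: "g ` {..<t} = pverts S"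
  proof -
    have "g ` {..<t} = g ` f ` pverts S" using fS by simp
    also have "\<dots> = pverts S" using gf by (auto simp: image_iff)
    finally show ?thesis .
  qed
  have "inj_on g {..<t}" using fg(1) by (metis inj_onI lessThan_iff)
  moreover have "map_prod g g ` parcs (complete_graph t) = parcs S"
  proof (rule subset_antisym)
    show "map_prod g g ` parcs (complete_graph t) \<subseteq> parcs S"
    proof clarsimp
      fix i j assume "(i, j) \<in> parcs (complete_graph t)"
      then have ij: "i < t" "j < t" "i \<noteq> j" by (auto simp: complete_graph_def)
      then have "touches (parcs S) {v\<in>pverts S. f v = i} {v\<in>pverts S. f v = j}"
        using model unfolding is_model_def by blast
      then obtain v w where "(v, w) \<in> parcs S" "v \<in> pverts S" "w \<in> pverts S" "f v = i" "f w = j"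
        unfolding touches_def by blast
      then show "(g i, g j) \<in> parcs S" using gf by metis
    qed
    show "parcs S \<subseteq> map_prod g g ` parcs (complete_graph t)"
    proof clarify
      fix v w assume vw: "(v, w) \<in> parcs S"
      then have "v \<in> pverts S" "w \<in> pverts S" "v \<noteq> w"
        using S.in_arcsD1 S.in_arcsD2 S.no_loops' by blast+
      moreover from this have "f v < t" "f w < t" "f v \<noteq> f w"
        using assms(2,3) by (auto dest: inj_onD)
      ultimately show "(v, w) \<in> map_prod g g ` parcs (complete_graph t)"
        by (intro rev_image_eqI[of "(f v, f w)"]) (auto simp: complete_graph_def gf)
    qed
  qed
  moreover have "pair_wf_digraph (complete_graph t)"
    by unfold_locales (auto simp: complete_graph_def)
  moreover have "pverts (complete_graph t) = {..<t}" by (simp add: complete_graph_def)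
  ultimately show ?thesis
    using digraph_iso_image[of "complete_graph t" g] gS
    by (metis (full_types) old.unit.exhaust pair_pre_digraph.surjective)
qed

text \<open>The labelling \<open>f\<close> names the branch set of each vertex. While two vertices
  share a label, connectedness of the fibre gives an arc inside it, and contracting this arc
  preserves the model. The start \<open>S0\<close> stays fixed because \<open>contracts_to\<close>
  appends its steps at the end.\<close>

lemma contracts_to_complete_graph:
  assumes "contracts_to S0 S" "pair_graph S" "f ` pverts S \<subseteq> {..<t}"
    and "is_model (parcs S) {..<t} (\<lambda>i. {v\<in>pverts S. f v = i})"
  shows "\<exists>G'. contracts_to S0 G' \<and> digraph_iso (with_proj (complete_graph t)) (with_proj G')"
  using assms
proof (induction "card (pverts S)" arbitrary: S rule: less_induct)
  case less
  interpret S: pair_graph S by fact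
  show ?case
  proof (cases "inj_on f (pverts S)")
    case True
    then show ?thesis using complete_graph_if_model less.prems by blast
  next
    case False
    then obtain u v0 where u: "u \<in> pverts S" "v0 \<in> pverts S" "f u = f v0" "u \<noteq> v0"
      unfolding inj_on_def by blast
    let ?F = "\<lambda>S i. {v\<in>pverts S. f v = i}"
    have "f u < t" using u less.prems(3) by auto
    then have "connected_in (parcs S) (?F S (f u))"
      using less.prems(4) unfolding is_model_def by blast
    then have "touches (parcs S) {u} (?F S (f u) - {u})"
      by (rule connected_in_cut) (use u in auto)
    then obtain v where v: "(u, v) \<in> parcs S" "v \<in> pverts S" "f v = f u"
      unfolding touches_def by blast
    have uv: "u \<noteq> v" using v S.no_loops' by blast
    define S' where "S' = contract_edge S u v"
    define h where "h = (\<lambda>x. if x = v then u else x)"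
    have S': "pair_graph S'" "pverts S' = pverts S - {v}"
      using pair_graph_contract_edge[OF less.prems(2) v(1)] unfolding S'_def by auto
    have harc: "(h a, h b) \<in> parcs S'" if "(a, b) \<in> parcs S" "h a \<noteq> h b" for a b
    proof -
      have "parcs S' = {(h a, h b) | a b. (a, b) \<in> parcs S \<and> h a \<noteq> h b}"
        by (simp only: S'_def contract_edge_def Let_def h_def pair_pre_digraph.simps)
      then show ?thesis using that by blast
    qed
    have hF: "h ` ?F S i = ?F S' i" for i
    proof
      show "h ` ?F S i \<subseteq> ?F S' i" using u(1) v(3) uv unfolding S'(2) h_def by auto
      show "?F S' i \<subseteq> h ` ?F S i" unfolding S'(2) by (auto intro!: rev_image_eqI simp: h_def)
    qed
    have "is_model (parcs S') {..<t} (?F S')"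
      unfolding is_model_def
    proof (intro conjI ballI impI)
      fix i assume "i \<in> {..<t}"
      then have "connected_in (parcs S) (?F S i)"
        using less.prems(4) unfolding is_model_def by blast
      then have "connected_in (parcs S') (h ` ?F S i)"
        by (rule connected_in_image) (rule harc)
      then show "connected_in (parcs S') (?F S' i)" unfolding hF .
    next
      fix i j assume ij: "i \<in> {..<t}" "j \<in> {..<t}" "i \<noteq> j"
      then have "touches (parcs S) (?F S i) (?F S j)"
        using less.prems(4) unfolding is_model_def by blast
      then obtain a b where ab: "a \<in> ?F S i" "b \<in> ?F S j" "(a, b) \<in> parcs S"
        unfolding touches_def by blast
      then have "h a \<in> ?F S' i" "h b \<in> ?F S' j" using hF by blast+
      moreover from this have "h a \<noteq> h b" using ij by auto
      ultimately show "touches (parcs S') (?F S' i) (?F S' j)"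
        using harc ab unfolding touches_def by blast
      show "?F S' i \<inter> ?F S' j = {}" using ij by blast
    qed
    moreover have "card (pverts S') < card (pverts S)"
      unfolding S'(2) using v(2) by (intro card_Diff1_less) auto
    moreover have "contracts_to S0 S'"
      unfolding S'_def by (rule contracts_to.step[OF less.prems(1) v(1)])
    moreover have "f ` pverts S' \<subseteq> {..<t}" using less.prems(3) S'(2) by blast
    ultimately show ?thesis using less.hyps S'(1) by blast
  qed
qed

text \<open>An injection selects exactly \<open>t\<close> branch sets, and \<open>S\<close> is
  induced on their union, so that every vertex of \<open>S\<close> gets a label below
  \<open>t\<close>.\<close>

lemma is_minor_if_model:
  assumes G: "pair_graph G" and model: "is_model (parcs G) Q A" and sub: "\<And>j. j \<in> Q \<Longrightarrow> A j \<subseteq> pverts G"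
    and "finite Q" "t \<le> card Q"
  shows "is_minor (complete_graph t) G"
proof -
  interpret G: pair_graph G by fact
  obtain e where e: "inj_on e {..<t}" "e ` {..<t} \<subseteq> Q"
    using inj_on_iff_card_le[of "{..<t}" Q] assms(4,5) by auto
  define B where "B i = A (e i)" for i
  have B: "connected_in (parcs G) (B i)" "B i \<subseteq> pverts G" if "i < t" for i
    using that e model sub unfolding is_model_def B_def by blast+
  have B2: "B i \<inter> B j = {}" "touches (parcs G) (B i) (B j)" if "i < t" "j < t" "i \<noteq> j" for i j
  proof -
    have "e i \<in> Q" "e j \<in> Q" "e i \<noteq> e j" using e that by (auto dest: inj_onD)
    then show "B i \<inter> B j = {}" "touches (parcs G) (B i) (B j)"
      using model unfolding is_model_def B_def by blast+
  qed
  define V where "V = (\<Union>i<t. B i)"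
  define S where "S = \<lparr>pverts = V, parcs = parcs G \<inter> V \<times> V\<rparr>"
  have VG: "V \<subseteq> pverts G" using B unfolding V_def by blast
  have S: "pair_graph S"
  proof
    show "symmetric (with_proj S)"
      unfolding symmetric_def with_proj_simps S_def
      by (rule symI) (auto dest: G.arcs_symmetric)
    show "finite (pverts S)" using VG unfolding S_def by (simp add: finite_subset)
  qed (auto simp: S_def dest: G.no_loops')
  then interpret S: pair_graph S .
  have subgraph: "subgraph (with_proj S) (with_proj G)"
    unfolding subgraph_def
    using VG S.wf_digraph_axioms G.wf_digraph_axioms by (auto simp: S_def)
  define f where "f v = (THE i. i < t \<and> v \<in> B i)" for v
  have f: "f v = i" if "i < t" "v \<in> B i" for v i
    unfolding f_def using that B2(1) by (intro the_equality) blast+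
  have fib: "{v\<in>pverts S. f v = i} = B i" if "i < t" for i
    using that f unfolding S_def V_def by auto
  have "f ` pverts S \<subseteq> {..<t}" using f unfolding S_def V_def by auto
  moreover have "is_model (parcs S) {..<t} (\<lambda>i. {v\<in>pverts S. f v = i})"
    unfolding is_model_def
  proof (intro conjI ballI impI)
    fix i assume "i \<in> {..<t}"
    then have i: "i < t" by simp
    then have "B i \<subseteq> V" unfolding V_def by blast
    then have "connected_in (parcs S) (id ` B i)"
      by (intro connected_in_image[OF B(1)[OF i]]) (auto simp: S_def)
    then show "connected_in (parcs S) {v\<in>pverts S. f v = i}" using fib[OF i] by simp
  next
    fix i j assume "i \<in> {..<t}" "j \<in> {..<t}" and ij: "i \<noteq> j"
    then have t: "i < t" "j < t" by auto
    then have "B i \<subseteq> V" "B j \<subseteq> V" unfolding V_def by blast+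
    then have "touches (parcs S) (B i) (B j)"
      using B2(2)[OF t ij] unfolding touches_def S_def by auto
    then show "touches (parcs S) {v\<in>pverts S. f v = i} {v\<in>pverts S. f v = j}"
      using fib t by simp
    show "{v\<in>pverts S. f v = i} \<inter> {v\<in>pverts S. f v = j} = {}" using ij by blast
  qed
  ultimately obtain G' where "contracts_to S G'"
    "digraph_iso (with_proj (complete_graph t)) (with_proj G')"
    using contracts_to_complete_graph[OF contracts_to.refl S] by blast
  then show ?thesis using S subgraph unfolding is_minor_def by blast
qed

section \<open>The path factor and layered treewidth\<close>

definition path_graph :: "nat \<Rightarrow> nat pair_pre_digraph" where
  "path_graph M = \<lparr>pverts = {..<M}, parcs = {(i, j). i < M \<and> j < M \<and> (j = Suc i \<or> i = Suc j)}\<rparr>"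

lemma set_vwalk_arcs_upt: "set (vwalk_arcs [0..<M]) = {(i, j). j < M \<and> j = Suc i}"
proof (induction M)
  case (Suc M)
  show ?case
  proof (cases "M = 0")
    case False
    then have "vwalk_arcs [0..<Suc M] = vwalk_arcs [0..<M] @ [(M - 1, M)]"
      using vwalk_arcs_append[of "[0..<M]" "[M]"] by (simp add: last_upt)
    then show ?thesis using Suc False by auto
  qed auto
qed simp

lemma is_path_path_graph: "0 < M \<Longrightarrow> is_path (path_graph M)"
  unfolding is_path_def path_graph_def
  by (intro exI[of _ "[0..<M]"]) (auto simp: set_vwalk_arcs_upt)

lemma pair_graph_path_graph: "pair_graph (path_graph M)"
proof
  have "parcs (path_graph M) \<subseteq> {..<M} \<times> {..<M}" by (auto simp: path_graph_def)
  then show "finite (parcs (path_graph M))" by (rule finite_subset) simp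
qed (auto simp: path_graph_def symmetric_def sym_def)

lemma pair_graph_complete_graph: "pair_graph (complete_graph n)"
proof
  have "parcs (complete_graph n) \<subseteq> {..<n} \<times> {..<n}" by (auto simp: complete_graph_def)
  then show "finite (parcs (complete_graph n))" by (rule finite_subset) simp
qed (auto simp: complete_graph_def symmetric_def sym_def)

text \<open>The minimum is attained because a candidate exists: a one-node tree whose bag is
  everything, with all vertices in layer \<open>0\<close>.\<close>

lemma layered_treewidth_witness:
  assumes "pair_graph G"
  obtains L W and T :: "nat pair_pre_digraph" where "layering G L" "tree_decomposition G T W"
    "\<And>i x. x \<in> pverts T \<Longrightarrow> card (L i \<inter> W x) \<le> layered_treewidth G"
proof -
  interpret pair_graph G by fact
  let ?T = "parent_tree 1 id" and ?W = "\<lambda>_::nat. pverts G"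
  let ?L = "\<lambda>i::nat. if i = 0 then pverts G else {}"
  have "is_tree ?T" by (rule is_tree_parent_tree) auto
  moreover from this have "sym (parcs ?T)" using pair_graph_sym unfolding is_tree_def by blast
  moreover have "pverts ?T = {0}" by (auto simp: parent_tree_def)
  ultimately have "tree_decomposition G ?T ?W"
    unfolding tree_decomposition_def
    by (auto simp: connected_restrict_iff connected_in_singleton dest: in_arcsD1 in_arcsD2)
  moreover have "layering G ?L" unfolding layering_def by (auto split: if_splits)
  moreover have "card (?L i \<inter> ?W x) \<le> card (pverts G)" for i x by (auto intro: card_mono)
  ultimately have "\<exists>k L (T :: nat pair_pre_digraph) W. layering G L \<and> tree_decomposition G T W \<and>
     (\<forall>i. \<forall>x\<in>pverts T. card (L i \<inter> W x) \<le> k)" by blast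
  from LeastI_ex[OF this] show thesis
    using that unfolding layered_treewidth_def by blast
qed

section \<open>Assembling the embedding into the product\<close>

theorem theorem17:
  fixes G :: "'a pair_pre_digraph" and t :: nat
  assumes "t \<ge> 2"
    and "pair_graph G"
    and "minor_free (complete_graph t) G"
  shows "\<exists>(H :: nat pair_pre_digraph) (P :: nat pair_pre_digraph).
    pair_graph H \<and> treewidth H \<le> t - 2 \<and> is_path P \<and>
    isomorphic_to_subgraph G (H \<boxtimes> P \<boxtimes> complete_graph (layered_treewidth G))"
proof -
  let ?V = "pverts G" and ?E = "parcs G" and ?m = "layered_treewidth G"
  interpret pair_graph G by fact
  obtain L W and T :: "nat pair_pre_digraph" where L: "layering G L"
    and TW: "tree_decomposition G T W"
    and bound: "\<And>i x. x \<in> pverts T \<Longrightarrow> card (L i \<inter> W x) \<le> ?m"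
    by (rule layered_treewidth_witness[OF assms(2)]) (rule that)
  \<comment> \<open>\<open>Suc (t - 2)\<close> equals \<open>t - 1\<close> because \<open>t\<close>
    is at least two; a larger model would yield the complete graph on \<open>t\<close> vertices as a
    minor.\<close>
  have no_model: "\<forall>Q A. is_model ?E (Q :: nat set) A \<and> finite Q \<and> (\<forall>j\<in>Q. A j \<subseteq> ?V) \<longrightarrow>
    card Q \<le> Suc (t - 2)"
  proof (intro allI impI)
    fix Q :: "nat set" and A assume QA: "is_model ?E Q A \<and> finite Q \<and> (\<forall>j\<in>Q. A j \<subseteq> ?V)"
    have "\<not> t \<le> card Q"
    proof
      assume "t \<le> card Q"
      then have "is_minor (complete_graph t) G"
        using is_minor_if_model[OF assms(2), of Q A] QA by blast
      then show False using assms(3) unfolding minor_free_def by blast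
    qed
    then show "card Q \<le> Suc (t - 2)" using assms(1) by simp
  qed
  have "tree_like (parcs T) (pverts T)"
    using TW tree_like_if_is_tree unfolding tree_decomposition_def by blast
  from bag_partition_exists[OF pair_graph_sym[OF assms(2)] this
      decomposes_if_tree_decomposition[OF TW] pair_finite_verts no_model]
  obtain N X Qs where N: "0 < N" and order: "elimination_order (t - 2) N Qs"
    and part: "partial_partition ?V ?E (W ` pverts T) N X Qs" and cover: "?V = (\<Union>i<N. X i)"
    by metis
  define H where "H = elimination_graph N Qs"
  have H: "pair_graph H" "treewidth H \<le> t - 2"
    unfolding H_def using pair_graph_elimination_graph treewidth_elimination_graph order N by blast+
  have "\<forall>v\<in>?V. \<exists>i<N. v \<in> X i" using cover by blast
  then obtain part_of where po: "\<And>v. v \<in> ?V \<Longrightarrow> part_of v < N \<and> v \<in> X (part_of v)" by metis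
  have "\<forall>v\<in>?V. \<exists>l. v \<in> L l" using L unfolding layering_def by blast
  then obtain layer where layer: "\<And>v. v \<in> ?V \<Longrightarrow> v \<in> L (layer v)" by metis
  obtain M where M: "\<And>v. v \<in> ?V \<Longrightarrow> layer v < M" "0 < M"
  proof
    \<comment> \<open>For the null graph the maximum is unspecified, but the bound is then vacuous
      and the successor is still positive.\<close>
    show "layer v < Suc (Max (layer ` ?V))" if "v \<in> ?V" for v
      using that by (simp add: le_imp_less_Suc)
  qed simp
  \<comment> \<open>A part lies in one bag, so its intersection with a layer can be numbered
    injectively below \<open>?m\<close>.\<close>
  have "\<exists>c. inj_on c (X i \<inter> L l) \<and> c ` (X i \<inter> L l) \<subseteq> {..<?m}" if i: "i < N" for i l
  proof -
    obtain x where x: "x \<in> pverts T" "X i \<subseteq> W x" "X i \<subseteq> ?V"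
      using part i unfolding partial_partition_def by blast
    have "finite (W x)"
      using TW x(1) finite_subset[OF _ pair_finite_verts] unfolding tree_decomposition_def by blast
    then have "card (X i \<inter> L l) \<le> card (L l \<inter> W x)" using x(2) by (intro card_mono) auto
    also have "\<dots> \<le> ?m" by (rule bound[OF x(1)])
    finally show ?thesis
      using x(3) finite_subset[OF _ pair_finite_verts]
      by (subst inj_on_iff_card_le) auto
  qed
  then obtain c where c: "\<And>i l. i < N \<Longrightarrow> inj_on (c i l) (X i \<inter> L l)"
    "\<And>i l. i < N \<Longrightarrow> c i l ` (X i \<inter> L l) \<subseteq> {..<?m}"
    by metis
  \<comment> \<open>A vertex is determined by its part, its layer and its number within their
    intersection.\<close>
  define g where "g v = ((part_of v, layer v), c (part_of v) (layer v) v)" for v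
  have inj: "inj_on g ?V"
  proof (rule inj_onI)
    fix v w assume vw: "v \<in> ?V" "w \<in> ?V" "g v = g w"
    then show "v = w"
      using po[of v] po[of w] layer[of v] layer[of w] inj_onD[OF c(1)[of "part_of v" "layer v"], of v w]
      unfolding g_def by auto
  qed
  have mem: "c (part_of v) (layer v) v < ?m" if "v \<in> ?V" for v
    using po[OF that] layer[OF that] c(2)[of "part_of v" "layer v"] by blast
  have "isomorphic_to_subgraph G (H \<boxtimes> path_graph M \<boxtimes> complete_graph ?m)"
  proof (rule isomorphic_to_subgraphI[OF assms(2) _ inj])
    show "pair_graph (H \<boxtimes> path_graph M \<boxtimes> complete_graph ?m)"
      by (intro pair_graph_strong_product H(1) pair_graph_path_graph pair_graph_complete_graph)
    show verts: "g v \<in> pverts (H \<boxtimes> path_graph M \<boxtimes> complete_graph ?m)" if "v \<in> ?V" for v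
      using po[OF that] M(1)[OF that] mem[OF that]
      by (simp add: g_def strong_product_def H_def elimination_graph_def path_graph_def complete_graph_def)
    fix v w assume vw: "(v, w) \<in> ?E"
    then have V: "v \<in> ?V" "w \<in> ?V" and "v \<noteq> w" using in_arcsD1 in_arcsD2 no_loops' by blast+
    \<comment> \<open>The ends of an arc of the product must differ in some coordinate; in each
      single coordinate they may agree.\<close>
    then have "g v \<noteq> g w" using inj by (auto dest: inj_onD)
    have h: "part_of v = part_of w \<or> (part_of v, part_of w) \<in> parcs H"
    proof (cases "part_of v" "part_of w" rule: linorder_cases)
      case less
      then have "part_of v \<in> Qs (part_of w)"
        using part vw po[OF V(1)] po[OF V(2)] unfolding partial_partition_def touches_def by blast
      then show ?thesis using po V unfolding H_def elimination_graph_def by simp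
    next
      case greater
      then have "part_of w \<in> Qs (part_of v)"
        using part arcs_symmetric[OF vw] po[OF V(1)] po[OF V(2)]
        unfolding partial_partition_def touches_def by blast
      then show ?thesis using po V unfolding H_def elimination_graph_def by simp
    qed simp
    have "\<bar>int (layer v) - int (layer w)\<bar> \<le> 1"
      using L vw layer[OF V(1)] layer[OF V(2)] unfolding layering_def by blast
    then have p: "layer v = layer w \<or> (layer v, layer w) \<in> parcs (path_graph M)"
      using M(1)[OF V(1)] M(1)[OF V(2)] unfolding path_graph_def by auto
    have k: "c (part_of v) (layer v) v = c (part_of w) (layer w) w \<or>
      (c (part_of v) (layer v) v, c (part_of w) (layer w) w) \<in> parcs (complete_graph ?m)"
      using mem[OF V(1)] mem[OF V(2)] unfolding complete_graph_def by simp
    show "(g v, g w) \<in> parcs (H \<boxtimes> path_graph M \<boxtimes> complete_graph ?m)"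
      using verts[OF V(1)] verts[OF V(2)] h p k \<open>g v \<noteq> g w\<close>
      unfolding g_def strong_product_def by auto
  qed
  then show ?thesis using H is_path_path_graph[OF M(2)] by blast
qed

end
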